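(* The following formulas hold in $\mathrm{QSym}_{\mathbb C(q)}$. (a) Let $m,n$ be nonnegative integers, $I\subseteq[m-1]$ and $J\subseteq[n-1]$. Then $$M_{\mathrm{comp}(I)}(q)\,M_{\mathrm{comp}(J)}(q)=\sum_{A\subseteq[m+n],\,|A|=n}(1-q)^{|\overline{\mathsf e}(A)\setminus(I\#_AJ)|-1}\left(\sum_{S\subseteq\mathsf e(A^{\mathrm c})}q^{|S|}M_{\mathrm{comp}((I\sqcup\!\sqcup_AJ)\sqcup S)}(q)\right).$$ (b) For every composition $\gamma$, $$\triangle M_\gamma(q)=\sum_{\alpha\cdot\beta=\gamma\ \text{or}\ \alpha\odot\beta=\gamma}(1-q)^{\gamma(\alpha,\beta)}\,M_\alpha(q)\otimes M_\beta(q),$$ where the sum is over pairs $(\alpha,\beta)$ of (possibly empty) compositions, and $\gamma(\alpha,\beta)=0$ if $\alpha\odot\beta=\gamma$ and $\gamma(\alpha,\beta)=1$ otherwise.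
   Context: Notation: $[k]=\{1,\dots,k\}$ for $k\ge1$ and $[k]=\emptyset$ for $k\le 0$. A composition is a finite (possibly empty) tuple of positive integers; $\ell(\alpha)$ is its length. For $n\ge1$, $I=\{s_1<\dots<s_i\}\subseteq[n-1]$ corresponds to the composition $\mathrm{comp}(I)=(s_1,s_2-s_1,\dots,n-s_i)$ of $n$ (with $\mathrm{comp}(\emptyset)=(n)$); for $n=0$, $\mathrm{comp}(\emptyset)$ is the empty composition. $\beta\preceq\alpha$ means that $\beta$ refines $\alpha$ ($\alpha$ is obtained from $\beta$ by adding together adjacent parts). $\alpha\cdot\beta$ is concatenation; $\alpha\odot\beta=(\alpha_1,\dots,\alpha_{l-1},\alpha_l+\beta_1,\beta_2,\dots,\beta_k)$ is near-concatenation for nonempty $\alpha=(\alpha_1,\dots,\alpha_l)$, $\beta=(\beta_1,\dots,\beta_k)$, with $\alpha\odot\emptyset=\alpha$, $\emptyset\odot\beta=\beta$. $\mathrm{QSym}_{\mathbb C(q)}$ is the Hopf algebra of quasisymmetric functions over $\mathbb C(q)$. $M_\alpha=\sum_{i_1<\dots<i_l}x_{i_1}^{\alpha_1}\cdots x_{i_l}^{\alpha_l}$ is the monomial quasisymmetric function, the coproduct is $\triangle M_\alpha=\sum_{\beta\cdot\gamma=\alpha}M_\beta\otimes M_\gamma$, and $L_\alpha=\sum_{\beta\preceq\alpha}M_\beta$ is the fundamental quasisymmetric function. The $q$-analogue of $M_\alpha$ is $$M_\alpha(q)=\sum_{\beta\preceq\alpha}(-q)^{\ell(\beta)-\ell(\alpha)}L_\beta.$$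 For $A\subseteq[N]$ put $A^{\mathrm c}=[N]\setminus A$, $\mathsf e(A)=\{i\in[N-1]: i\in A,\ i+1\notin A\}$, $\overline{\mathsf e}(A)=\mathsf e(A)\sqcup\mathsf e(A^{\mathrm c})$ (here $N=m+n$). For an $n$-element subset $A=\{a_1<\dots<a_n\}\subseteq[m+n]$ with $A^{\mathrm c}=\{b_1<\dots<b_m\}$: $I\#_AJ=\{b_i:i\in I\}\sqcup\{a_j:j\in J\}\subseteq[m+n-1]$ and $I\sqcup\!\sqcup_AJ=\mathsf e(A)\sqcup\big((I\#_AJ)\setminus\overline{\mathsf e}(A)\big)$.
   Formalization: In (b) the cases of γ(α,β) are swapped: it is 0 if α·β=γ and 1 otherwise (as printed, (b) fails for γ=(1,1)). In (a) the exponent of 1−q is taken as 0 instead of −1 when m=0 or n=0 (as printed, m=n=0 would give 1=(1−q)^{-1}). *)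

theory Defs
  imports
    "HOL-Library.Poly_Mapping"
    "HOL-Computational_Algebra.Polynomial_Factorial"
begin

section \<open>Compositions\<close>

definition composition :: "nat list \<Rightarrow> bool" where
  "composition \<alpha> \<longleftrightarrow> (\<forall>a\<in>set \<alpha>. 0 < a)"

definition comp_of :: "nat \<Rightarrow> nat set \<Rightarrow> nat list" where
  "comp_of n I = (if n = 0 then []
     else map2 (\<lambda>t s. t - s) (sorted_list_of_set I @ [n]) (0 # sorted_list_of_set I))"

definition refines :: "nat list \<Rightarrow> nat list \<Rightarrow> bool" where
  "refines \<beta> \<alpha> \<longleftrightarrow> (\<exists>bs. (\<forall>b\<in>set bs. b \<noteq> []) \<and> concat bs = \<beta> \<and> map sum_list bs = \<alpha>)"

definition near_concat :: "nat list \<Rightarrow> nat list \<Rightarrow> nat list" (infixr "\<odot>" 65) where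
  "\<alpha> \<odot> \<beta> = (if \<alpha> = [] then \<beta> else if \<beta> = [] then \<alpha>
     else butlast \<alpha> @ (last \<alpha> + hd \<beta>) # tl \<beta>)"

lemma finite_compositions: "finite {\<alpha>. composition \<alpha> \<and> sum_list \<alpha> \<le> d}"
proof (rule finite_subset)
  have len: "length \<alpha> \<le> sum_list \<alpha>" if "composition \<alpha>" for \<alpha>
    using that unfolding composition_def by (induction \<alpha>) fastforce+
  show "{\<alpha>. composition \<alpha> \<and> sum_list \<alpha> \<le> d} \<subseteq> {\<alpha>. set \<alpha> \<subseteq> {..d} \<and> length \<alpha> \<le> d}"
    using len member_le_sum_list by (fastforce dest: le_trans)
qed (rule finite_lists_length_le, simp)

lemma refines_sum_list: "refines \<beta> \<alpha> \<Longrightarrow> sum_list \<beta> = sum_list \<alpha>"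
proof -
  have "sum_list (concat bs) = sum_list (map sum_list bs)" for bs :: "nat list list"
    by (induction bs) auto
  then show "refines \<beta> \<alpha> \<Longrightarrow> sum_list \<beta> = sum_list \<alpha>" unfolding refines_def by metis
qed

lemma finite_refinements: "finite {\<beta>. composition \<beta> \<and> refines \<beta> \<alpha>}"
  by (rule finite_subset[OF _ finite_compositions[of "sum_list \<alpha>"]])
     (auto dest: refines_sum_list)


section \<open>Quasisymmetric functions\<close>

text \<open>
  A monomial in the variables \<open>x\<^sub>0, x\<^sub>1, \<dots>\<close> is its exponent vector, of type \<open>nat \<Rightarrow>\<^sub>0 nat\<close>, and a
  formal power series is its coefficient function.
\<close>

definition xmon :: "nat list \<Rightarrow> nat list \<Rightarrow> (nat \<Rightarrow>\<^sub>0 nat)" where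
  "xmon is \<alpha> = sum_list (map2 Poly_Mapping.single is \<alpha>)"

definition xdeg :: "(nat \<Rightarrow>\<^sub>0 nat) \<Rightarrow> nat" where
  "xdeg m = (\<Sum>i\<in>Poly_Mapping.keys m. Poly_Mapping.lookup m i)"

definition quasisymmetric :: "((nat \<Rightarrow>\<^sub>0 nat) \<Rightarrow> 'a) \<Rightarrow> bool" where
  "quasisymmetric f \<longleftrightarrow> (\<forall>\<alpha> is js. composition \<alpha> \<and> length is = length \<alpha> \<and> length js = length \<alpha> \<and>
     sorted_wrt (<) is \<and> sorted_wrt (<) js \<longrightarrow> f (xmon is \<alpha>) = f (xmon js \<alpha>))"

definition bounded_degree :: "((nat \<Rightarrow>\<^sub>0 nat) \<Rightarrow> 'a::zero) \<Rightarrow> bool" where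
  "bounded_degree f \<longleftrightarrow> (\<exists>d. \<forall>m. f m \<noteq> 0 \<longrightarrow> xdeg m \<le> d)"

definition cauchy_prod ::
  "((nat \<Rightarrow>\<^sub>0 nat) \<Rightarrow> 'a) \<Rightarrow> ((nat \<Rightarrow>\<^sub>0 nat) \<Rightarrow> 'a) \<Rightarrow> (nat \<Rightarrow>\<^sub>0 nat) \<Rightarrow> 'a::comm_ring_1" where
  "cauchy_prod f g m = (\<Sum>(a, b) | a + b = m. f a * g b)"

lemma xmon_simps [simp]:
  "xmon [] \<alpha> = 0" "xmon is [] = 0"
  "xmon (i # is) (a # \<alpha>) = Poly_Mapping.single i a + xmon is \<alpha>"
  by (auto simp: xmon_def)

lemma lookup_xmon_notin: "i \<notin> set is \<Longrightarrow> Poly_Mapping.lookup (xmon is \<alpha>) i = 0"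
proof (induction "is" arbitrary: \<alpha>)
  case (Cons k ks)
  then show ?case by (cases \<alpha>) (auto simp: lookup_add lookup_single)
qed simp

lemma lookup_xmon_nth:
  "distinct is \<Longrightarrow> length is = length \<alpha> \<Longrightarrow> j < length is \<Longrightarrow> Poly_Mapping.lookup (xmon is \<alpha>) (is ! j) = \<alpha> ! j"
proof (induction "is" arbitrary: \<alpha> j)
  case (Cons k ks)
  then obtain a \<beta> where \<alpha>: "\<alpha> = a # \<beta>" by (cases \<alpha>) auto
  show ?case
  proof (cases j)
    case 0
    then show ?thesis using Cons.prems \<alpha> by (simp add: lookup_add lookup_xmon_notin)
  next
    case (Suc j')
    then have "ks ! j' \<noteq> k" using Cons.prems by auto
    then show ?thesis using Cons.prems Cons.IH[of \<beta> j'] \<alpha> Suc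
      by (simp add: lookup_add lookup_single)
  qed
qed simp

lemma strict_sorted_distinct: "sorted_wrt (<) (is :: nat list) \<Longrightarrow> distinct is"
  using strict_sorted_iff by blast

lemma keys_xmon:
  assumes "distinct is" "length is = length \<alpha>" "composition \<alpha>"
  shows "Poly_Mapping.keys (xmon is \<alpha>) = set is"
proof -
  have "i \<in> set is" if "i \<in> Poly_Mapping.keys (xmon is \<alpha>)" for i
    using that lookup_xmon_notin by (metis in_keys_iff)
  moreover have "i \<in> Poly_Mapping.keys (xmon is \<alpha>)" if "i \<in> set is" for i
    using that assms by (metis in_keys_iff in_set_conv_nth lookup_xmon_nth composition_def nth_mem
        less_irrefl)
  ultimately show ?thesis by blast
qed

lemma xmon_inject:
  assumes "sorted_wrt (<) is" "sorted_wrt (<) js" "length is = length \<alpha>" "length js = length \<beta>"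
    and "composition \<alpha>" "composition \<beta>" "xmon is \<alpha> = xmon js \<beta>"
  shows "is = js" "\<alpha> = \<beta>"
proof -
  have "set is = set js"
    using assms keys_xmon strict_sorted_distinct by metis
  then show eq: "is = js"
    using assms by (simp add: strict_sorted_equal)
  show "\<alpha> = \<beta>"
    using assms eq lookup_xmon_nth strict_sorted_distinct by (metis nth_equalityI)
qed

lemma xmon_drop_zeros:
  assumes "length is = length \<alpha>"
  shows "xmon is \<alpha> = xmon (map fst (filter (\<lambda>(i, a). a \<noteq> 0) (zip is \<alpha>))) (filter (\<lambda>a. a \<noteq> 0) \<alpha>)"
  using assms by (induction "is" \<alpha> rule: list_induct2) auto

lemma quasisymmetric_weak:
  assumes f: "quasisymmetric f" and len: "length is = length \<alpha>" "length js = length \<alpha>"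
    and srt: "sorted_wrt (<) is" "sorted_wrt (<) js"
  shows "f (xmon is \<alpha>) = f (xmon js \<alpha>)"
proof -
  let ?F = "\<lambda>ks. map fst (filter (\<lambda>(i, a). a \<noteq> 0) (zip ks \<alpha>))"
  have srtF: "sorted_wrt (<) (?F ks)" if "sorted_wrt (<) ks" "length ks = length \<alpha>" for ks :: "nat list"
    using that(2,1)
  proof (induction ks \<alpha> rule: list_induct2)
    case (Cons x xs y ys)
    then show ?case by (auto dest: set_zip_leftD)
  qed simp
  have lenF: "length (?F ks) = length (filter (\<lambda>a. a \<noteq> 0) \<alpha>)" if "length ks = length \<alpha>" for ks :: "nat list"
    using that by (induction ks \<alpha> rule: list_induct2) auto
  have "composition (filter (\<lambda>a. a \<noteq> 0) \<alpha>)" by (auto simp: composition_def)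
  then have "f (xmon (?F is) (filter (\<lambda>a. a \<noteq> 0) \<alpha>)) = f (xmon (?F js) (filter (\<lambda>a. a \<noteq> 0) \<alpha>))"
    using f srtF[OF srt(1) len(1)] srtF[OF srt(2) len(2)] lenF[OF len(1)] lenF[OF len(2)]
    unfolding quasisymmetric_def by blast
  then show ?thesis
    by (simp only: xmon_drop_zeros[OF len(1), symmetric] xmon_drop_zeros[OF len(2), symmetric])
qed

lemma finite_splits: "finite {(a, b). a + b = (m :: nat \<Rightarrow>\<^sub>0 nat)}"
proof -
  let ?S = "{a. \<exists>b. a + b = m}"
  let ?B = "{..(\<Sum>i\<in>Poly_Mapping.keys m. Poly_Mapping.lookup m i)}"
  have "Poly_Mapping.lookup a i \<in> ?B \<and> (i \<notin> Poly_Mapping.keys m \<longrightarrow> Poly_Mapping.lookup a i = 0)" if "a \<in> ?S" for a i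
  proof -
    have le: "Poly_Mapping.lookup a i \<le> Poly_Mapping.lookup m i" using that by (auto simp: lookup_add)
    show ?thesis
    proof (cases "i \<in> Poly_Mapping.keys m")
      case True
      then have "Poly_Mapping.lookup m i \<le> (\<Sum>i\<in>Poly_Mapping.keys m. Poly_Mapping.lookup m i)"
        by (intro member_le_sum) auto
      then show ?thesis using le True by auto
    qed (use le in \<open>auto simp: in_keys_iff\<close>)
  qed
  then have "Poly_Mapping.lookup ` ?S \<subseteq> {f. \<forall>i. (i \<in> Poly_Mapping.keys m \<longrightarrow> f i \<in> ?B) \<and> (i \<notin> Poly_Mapping.keys m \<longrightarrow> f i = 0)}"
    by (intro image_subsetI CollectI allI conjI impI) (simp_all only: simp_thms)
  moreover have "finite {f. \<forall>i. (i \<in> Poly_Mapping.keys m \<longrightarrow> f i \<in> ?B) \<and> (i \<notin> Poly_Mapping.keys m \<longrightarrow> f i = (0::nat))}"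
    by (rule finite_set_of_finite_funs) auto
  ultimately have "finite (Poly_Mapping.lookup ` ?S)" by (rule finite_subset)
  then have "finite ?S"
    by (rule finite_imageD) (rule inj_onI, rule poly_mapping_eqI, simp only:)
  then have "finite ((\<lambda>a. (a, m - a)) ` ?S)" by simp
  moreover have "{(a, b). a + b = m} \<subseteq> (\<lambda>a. (a, m - a)) ` ?S"
  proof (clarify, rule image_eqI)
    fix a b assume "m = a + b"
    then show "(a, b) = (a, a + b - a)" "a \<in> {a'. \<exists>b'. a' + b' = a + b}" by (simp, blast)
  qed
  ultimately show ?thesis by (rule rev_finite_subset)
qed

lemma xdeg_superset: "finite A \<Longrightarrow> Poly_Mapping.keys m \<subseteq> A \<Longrightarrow> xdeg m = (\<Sum>i\<in>A. Poly_Mapping.lookup m i)"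
  unfolding xdeg_def by (rule sum.mono_neutral_left) (auto simp: in_keys_iff)

lemma xdeg_add: "xdeg (a + b) = xdeg a + xdeg b"
proof -
  let ?A = "Poly_Mapping.keys a \<union> Poly_Mapping.keys b"
  have "Poly_Mapping.keys (a + b) \<subseteq> ?A" by (rule Poly_Mapping.keys_add)
  then show ?thesis
    by (simp add: xdeg_superset[of ?A] lookup_add sum.distrib)
qed

lemma xdeg_xmon: "length is = length \<alpha> \<Longrightarrow> xdeg (xmon is \<alpha>) = sum_list \<alpha>"
proof (induction "is" \<alpha> rule: list_induct2)
  case Nil then show ?case by (simp add: xdeg_def)
next
  case (Cons i "is" a \<alpha>)
  have "xdeg (Poly_Mapping.single i a) = a" by (cases "a = 0") (simp_all add: xdeg_def)
  with Cons show ?case by (simp add: xdeg_add)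
qed

lemma cauchy_prod_xmon:
  assumes "sorted_wrt (<) is" "length is = length \<alpha>"
  shows "cauchy_prod f g (xmon is \<alpha>) =
    (\<Sum>\<beta> | length \<beta> = length \<alpha> \<and> (\<forall>j<length \<alpha>. \<beta> ! j \<le> \<alpha> ! j).
       f (xmon is \<beta>) * g (xmon is (map2 (-) \<alpha> \<beta>)))"
proof -
  let ?S = "{\<beta>. length \<beta> = length \<alpha> \<and> (\<forall>j<length \<alpha>. \<beta> ! j \<le> \<alpha> ! j)}"
  let ?h = "\<lambda>\<beta>. (xmon is \<beta>, xmon is (map2 (-) \<alpha> \<beta>))"
  have d: "distinct is" using assms(1) by (rule strict_sorted_distinct)
  have eqI: "p = r" if "\<And>i. i \<notin> set is \<Longrightarrow> Poly_Mapping.lookup p i = Poly_Mapping.lookup r i"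
      "\<And>j. j < length is \<Longrightarrow> Poly_Mapping.lookup p (is ! j) = Poly_Mapping.lookup r (is ! j)" for p r :: "nat \<Rightarrow>\<^sub>0 nat"
    using that by (metis in_set_conv_nth poly_mapping_eqI)
  have "inj_on ?h ?S"
    using d assms(2) lookup_xmon_nth by (auto simp: inj_on_def intro!: nth_equalityI) metis
  moreover have "?h ` ?S = {(a, b). a + b = xmon is \<alpha>}"
  proof (intro equalityI subsetI)
    fix p assume "p \<in> ?h ` ?S"
    then obtain \<beta> where \<beta>: "\<beta> \<in> ?S" "p = ?h \<beta>" by blast
    have "xmon is \<beta> + xmon is (map2 (-) \<alpha> \<beta>) = xmon is \<alpha>"
      by (rule eqI) (use \<beta> d assms(2) in \<open>auto simp: lookup_add lookup_xmon_notin lookup_xmon_nth\<close>)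
    then show "p \<in> {(a, b). a + b = xmon is \<alpha>}" using \<beta> by auto
  next
    fix p assume "p \<in> {(a, b). a + b = xmon is \<alpha>}"
    then obtain a b where p: "p = (a, b)" and ab: "a + b = xmon is \<alpha>" by auto
    define \<beta> where "\<beta> = map (Poly_Mapping.lookup a) is"
    have nth: "Poly_Mapping.lookup a (is ! j) + Poly_Mapping.lookup b (is ! j) = \<alpha> ! j" if "j < length is" for j
      using ab lookup_xmon_nth[OF d assms(2) that] by (metis lookup_add)
    have notin: "Poly_Mapping.lookup a i = 0" "Poly_Mapping.lookup b i = 0" if "i \<notin> set is" for i
      using ab lookup_xmon_notin[OF that, of \<alpha>] by (metis lookup_add add_is_0)+
    have len: "length \<beta> = length \<alpha>" using assms(2) by (simp add: \<beta>_def)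
    have le: "\<beta> ! j \<le> \<alpha> ! j" if "j < length \<alpha>" for j
      using nth[of j] that assms(2) by (simp add: \<beta>_def)
    have a: "a = xmon is \<beta>"
      by (rule eqI) (use d len assms(2) notin in \<open>auto simp: lookup_xmon_notin lookup_xmon_nth \<beta>_def\<close>)
    have b: "b = xmon is (map2 (-) \<alpha> \<beta>)"
    proof (rule eqI)
      fix j assume j: "j < length is"
      have "\<alpha> ! j - Poly_Mapping.lookup a (is ! j) = Poly_Mapping.lookup b (is ! j)" using nth[OF j] by simp
      then show "Poly_Mapping.lookup b (is ! j) = Poly_Mapping.lookup (xmon is (map2 (-) \<alpha> \<beta>)) (is ! j)"
        using d j len assms(2) by (simp add: lookup_xmon_nth \<beta>_def)
    qed (simp add: lookup_xmon_notin notin)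
    show "p \<in> ?h ` ?S" using p a b len le by blast
  qed
  ultimately have "bij_betw ?h ?S {(a, b). a + b = xmon is \<alpha>}" by (simp add: bij_betw_def)
  from sum.reindex_bij_betw[OF this, of "\<lambda>(a, b). f a * g b"] show ?thesis
    by (simp add: cauchy_prod_def)
qed

typedef (overloaded) 'a qsym =
  "{f :: (nat \<Rightarrow>\<^sub>0 nat) \<Rightarrow> 'a::comm_ring_1. quasisymmetric f \<and> bounded_degree f}"
  by (rule exI[of _ "\<lambda>_. 0"]) (auto simp: quasisymmetric_def bounded_degree_def)

setup_lifting type_definition_qsym

lemma xmon_eq_0_iff:
  "length is = length \<alpha> \<Longrightarrow> composition \<alpha> \<Longrightarrow> xmon is \<alpha> = 0 \<longleftrightarrow> \<alpha> = []"
  using xdeg_xmon[of "is" \<alpha>] by (cases \<alpha>) (auto simp: composition_def xdeg_def)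

lemma bounded_degree_combine:
  assumes "bounded_degree f" "bounded_degree g"
    and "h 0 0 = 0"
  shows "bounded_degree (\<lambda>m. h (f m) (g m))"
proof -
  obtain d e where "\<And>m. f m \<noteq> 0 \<Longrightarrow> xdeg m \<le> d" "\<And>m. g m \<noteq> 0 \<Longrightarrow> xdeg m \<le> e"
    using assms by (auto simp: bounded_degree_def)
  then show ?thesis
    unfolding bounded_degree_def using assms(3) by (metis max.coboundedI1 max.coboundedI2)
qed

lemma quasisymmetric_combine:
  assumes "quasisymmetric f" "quasisymmetric g"
  shows "quasisymmetric (\<lambda>m. h (f m) (g m))"
  unfolding quasisymmetric_def
proof (intro allI impI)
  fix \<alpha> and "is" js :: "nat list"
  assume "composition \<alpha> \<and> length is = length \<alpha> \<and> length js = length \<alpha> \<and>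
    sorted_wrt (<) is \<and> sorted_wrt (<) js"
  then have "f (xmon is \<alpha>) = f (xmon js \<alpha>)" "g (xmon is \<alpha>) = g (xmon js \<alpha>)"
    using assms unfolding quasisymmetric_def by blast+
  then show "h (f (xmon is \<alpha>)) (g (xmon is \<alpha>)) = h (f (xmon js \<alpha>)) (g (xmon js \<alpha>))" by simp
qed

lemma quasisymmetric_cauchy_prod:
  assumes "quasisymmetric f" "quasisymmetric g"
  shows "quasisymmetric (cauchy_prod f g)"
  unfolding quasisymmetric_def
proof (intro allI impI, elim conjE)
  fix \<alpha> "is" js :: "nat list"
  assume len: "length is = length \<alpha>" "length js = length \<alpha>"
    and srt: "sorted_wrt (<) is" "sorted_wrt (<) js"
  have "f (xmon is \<beta>) = f (xmon js \<beta>)" "g (xmon is (map2 (-) \<alpha> \<beta>)) = g (xmon js (map2 (-) \<alpha> \<beta>))"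
    if "length \<beta> = length \<alpha>" for \<beta>
    using that len srt
    by (auto intro!: quasisymmetric_weak[OF assms(1)] quasisymmetric_weak[OF assms(2)])
  then show "cauchy_prod f g (xmon is \<alpha>) = cauchy_prod f g (xmon js \<alpha>)"
    unfolding cauchy_prod_xmon[OF srt(1) len(1)] cauchy_prod_xmon[OF srt(2) len(2)]
    by (intro sum.cong refl) simp
qed

lemma bounded_degree_cauchy_prod:
  assumes "bounded_degree f" "bounded_degree g"
  shows "bounded_degree (cauchy_prod f g)"
proof -
  obtain d e where de: "\<And>m. f m \<noteq> 0 \<Longrightarrow> xdeg m \<le> d" "\<And>m. g m \<noteq> 0 \<Longrightarrow> xdeg m \<le> e"
    using assms by (auto simp: bounded_degree_def)
  have "xdeg m \<le> d + e" if "cauchy_prod f g m \<noteq> 0" for m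
  proof -
    have "\<exists>p\<in>{(a, b). a + b = m}. (case p of (a, b) \<Rightarrow> f a * g b) \<noteq> 0"
      using that unfolding cauchy_prod_def by (rule contrapos_np) (rule sum.neutral, simp)
    then obtain a b where ab: "a + b = m" "f a * g b \<noteq> 0" by auto
    then have "f a \<noteq> 0" "g b \<noteq> 0" by auto
    then show ?thesis using de ab(1) by (metis add_mono xdeg_add)
  qed
  then show ?thesis by (auto simp: bounded_degree_def)
qed

lemma cauchy_prod_commute: "cauchy_prod f g = cauchy_prod g f"
proof
  fix m
  show "cauchy_prod f g m = cauchy_prod g f m"
    unfolding cauchy_prod_def
    by (rule sum.reindex_bij_witness[of _ "\<lambda>(a, b). (b, a)" "\<lambda>(a, b). (b, a)"])
       (auto simp: ac_simps)
qed

lemma cauchy_prod_assoc: "cauchy_prod (cauchy_prod f g) h = cauchy_prod f (cauchy_prod g h)"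
proof
  fix m
  have "cauchy_prod (cauchy_prod f g) h m =
      (\<Sum>p\<in>{(a, b). a + b = m}. \<Sum>r\<in>{(a, b). a + b = fst p}. f (fst r) * g (snd r) * h (snd p))"
    by (simp add: cauchy_prod_def sum_distrib_right case_prod_unfold)
  also have "\<dots> = (\<Sum>(p, r)\<in>(SIGMA p:{(a, b). a + b = m}. {(a, b). a + b = fst p}).
      f (fst r) * g (snd r) * h (snd p))"
    by (rule sum.Sigma) (auto intro: finite_splits)
  also have "\<dots> = (\<Sum>(p, r)\<in>(SIGMA p:{(a, b). a + b = m}. {(a, b). a + b = snd p}).
      f (fst p) * (g (fst r) * h (snd r)))"
    by (rule sum.reindex_bij_witness[of _ "\<lambda>((a, _), (b, c)). ((a + b, c), (a, b))"
          "\<lambda>((_, c), (a, b)). ((a, b + c), (b, c))"]) (auto simp: ac_simps)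
  also have "\<dots> = (\<Sum>p\<in>{(a, b). a + b = m}. \<Sum>r\<in>{(a, b). a + b = snd p}. f (fst p) * (g (fst r) * h (snd r)))"
    by (rule sum.Sigma[symmetric]) (auto intro: finite_splits)
  also have "\<dots> = cauchy_prod f (cauchy_prod g h) m"
    by (simp add: cauchy_prod_def sum_distrib_left case_prod_unfold)
  finally show "cauchy_prod (cauchy_prod f g) h m = cauchy_prod f (cauchy_prod g h) m" .
qed

lemma cauchy_prod_one: "cauchy_prod (\<lambda>m. if m = 0 then 1 else 0) f = f"
proof
  fix m
  have "cauchy_prod (\<lambda>m. if m = 0 then 1 else 0) f m =
      (\<Sum>(a, b)\<in>{(0 :: nat \<Rightarrow>\<^sub>0 nat, m)}. (if a = 0 then 1 else 0) * f b)"
    unfolding cauchy_prod_def by (intro sum.mono_neutral_right finite_splits) (auto split: if_splits)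
  then show "cauchy_prod (\<lambda>m. if m = 0 then 1 else 0) f m = f m" by simp
qed

instantiation qsym :: (comm_ring_1) comm_ring_1
begin

lift_definition zero_qsym :: "'a qsym" is "\<lambda>_. 0"
  by (auto simp: quasisymmetric_def bounded_degree_def)

lift_definition one_qsym :: "'a qsym" is "\<lambda>m. if m = 0 then 1 else 0"
  by (auto simp: quasisymmetric_def bounded_degree_def xmon_eq_0_iff xdeg_def)

lift_definition plus_qsym :: "'a qsym \<Rightarrow> 'a qsym \<Rightarrow> 'a qsym" is "\<lambda>f g m. f m + g m"
  by (auto intro!: quasisymmetric_combine[where h = "(+)"] bounded_degree_combine[where h = "(+)"])

lift_definition minus_qsym :: "'a qsym \<Rightarrow> 'a qsym \<Rightarrow> 'a qsym" is "\<lambda>f g m. f m - g m"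
  by (auto intro!: quasisymmetric_combine[where h = "(-)"] bounded_degree_combine[where h = "(-)"])

lift_definition uminus_qsym :: "'a qsym \<Rightarrow> 'a qsym" is "\<lambda>f m. - f m"
  by (auto simp: bounded_degree_def intro: quasisymmetric_combine[of f f "\<lambda>x _. - x" for f])

lift_definition times_qsym :: "'a qsym \<Rightarrow> 'a qsym \<Rightarrow> 'a qsym" is cauchy_prod
  by (auto intro: quasisymmetric_cauchy_prod bounded_degree_cauchy_prod)

instance
proof
  fix a b c :: "'a qsym"
  show "a * b * c = a * (b * c)" by transfer (rule cauchy_prod_assoc)
  show "a * b = b * a" by transfer (rule cauchy_prod_commute)
  show "1 * a = a" by transfer (rule cauchy_prod_one)
  show "(a + b) * c = a * c + b * c"
    by transfer (simp add: cauchy_prod_def fun_eq_iff case_prod_unfold sum.distrib distrib_right)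
  show "(0 :: 'a qsym) \<noteq> 1" by transfer (auto simp: fun_eq_iff)
qed (transfer; simp add: fun_eq_iff algebra_simps)+

end

lift_definition qscale :: "'a::comm_ring_1 \<Rightarrow> 'a qsym \<Rightarrow> 'a qsym" (infixr "*\<^sub>Q" 75) is "\<lambda>c f m. c * f m"
  by (auto intro: quasisymmetric_combine[of f f "\<lambda>x _. c * x" for c f]
      bounded_degree_combine[of f f "\<lambda>x _. c * x" for c f])

text \<open>\<open>QM\<close>, \<open>QL\<close> and \<open>QMq q\<close> are the families \<open>M\<close>, \<open>L\<close> and \<open>M(q)\<close>; \<open>QM \<alpha>\<close> is set to \<open>0\<close> when \<open>\<alpha>\<close> is not a composition.\<close>

lift_definition QM :: "nat list \<Rightarrow> 'a::comm_ring_1 qsym" is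
  "\<lambda>\<alpha> m. if composition \<alpha> \<and> (\<exists>is. sorted_wrt (<) is \<and> length is = length \<alpha> \<and> m = xmon is \<alpha>)
         then 1 else 0"
proof (intro CollectI conjI)
  fix \<alpha>
  let ?f = "\<lambda>m. if composition \<alpha> \<and> (\<exists>is. sorted_wrt (<) is \<and> length is = length \<alpha> \<and> m = xmon is \<alpha>)
         then 1 else (0 :: 'a)"
  have "?f (xmon is \<gamma>) = (if \<gamma> = \<alpha> then 1 else 0)"
    if "composition \<gamma>" "length is = length \<gamma>" "sorted_wrt (<) is" for \<gamma> "is"
    using that xmon_inject(2) by (auto; metis)
  then show "quasisymmetric ?f" by (simp add: quasisymmetric_def)
  show "bounded_degree ?f"
    unfolding bounded_degree_def by (rule exI[of _ "sum_list \<alpha>"]) (auto simp: xdeg_xmon)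
qed

definition QL :: "nat list \<Rightarrow> 'a::comm_ring_1 qsym" where
  "QL \<alpha> = (\<Sum>\<beta> | composition \<beta> \<and> refines \<beta> \<alpha>. QM \<beta>)"

definition QMq :: "'a \<Rightarrow> nat list \<Rightarrow> 'a::comm_ring_1 qsym" where
  "QMq q \<alpha> = (\<Sum>\<beta> | composition \<beta> \<and> refines \<beta> \<alpha>. (- q) ^ (length \<beta> - length \<alpha>) *\<^sub>Q QL \<beta>)"

text \<open>
  The coefficient of \<open>QM \<alpha>\<close> in the expansion of \<open>f\<close> in the basis of monomial quasisymmetric functions.
\<close>

definition qcoeff :: "'a::comm_ring_1 qsym \<Rightarrow> nat list \<Rightarrow> 'a" where
  "qcoeff f \<alpha> = Rep_qsym f (xmon [0..<length \<alpha>] \<alpha>)"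

lemma qcoeff_QM: "composition \<alpha> \<Longrightarrow> composition \<beta> \<Longrightarrow> qcoeff (QM \<alpha>) \<beta> = (if \<beta> = \<alpha> then 1 else 0)"
proof -
  assume c: "composition \<alpha>" "composition \<beta>"
  have "(\<exists>is. sorted_wrt (<) is \<and> length is = length \<alpha> \<and> xmon [0..<length \<beta>] \<beta> = xmon is \<alpha>) \<longleftrightarrow> \<beta> = \<alpha>"
  proof
    assume "\<exists>is. sorted_wrt (<) is \<and> length is = length \<alpha> \<and> xmon [0..<length \<beta>] \<beta> = xmon is \<alpha>"
    then show "\<beta> = \<alpha>"
      using c xmon_inject(2)[of "[0..<length \<beta>]" _ \<beta> \<alpha>] by (auto simp: sorted_wrt_upt)
  next
    assume "\<beta> = \<alpha>"
    then show "\<exists>is. sorted_wrt (<) is \<and> length is = length \<alpha> \<and> xmon [0..<length \<beta>] \<beta> = xmon is \<alpha>"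
      by (intro exI[of _ "[0..<length \<beta>]"]) (auto simp: sorted_wrt_upt)
  qed
  then show ?thesis using c by (simp add: qcoeff_def QM.rep_eq)
qed

lemma qcoeff_add: "qcoeff (f + g) \<alpha> = qcoeff f \<alpha> + qcoeff g \<alpha>"
  by (simp add: qcoeff_def plus_qsym.rep_eq)

lemma qcoeff_scale: "qcoeff (c *\<^sub>Q f) \<alpha> = c * qcoeff f \<alpha>"
  by (simp add: qcoeff_def qscale.rep_eq)

lemma finite_qcoeff: "finite {\<alpha>. composition \<alpha> \<and> qcoeff f \<alpha> \<noteq> 0}"
proof -
  have "bounded_degree (Rep_qsym f)" using Rep_qsym[of f] by simp
  then obtain d where d: "\<And>m. Rep_qsym f m \<noteq> 0 \<Longrightarrow> xdeg m \<le> d" by (auto simp: bounded_degree_def)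
  have "{\<alpha>. composition \<alpha> \<and> qcoeff f \<alpha> \<noteq> 0} \<subseteq> {\<alpha>. composition \<alpha> \<and> sum_list \<alpha> \<le> d}"
    using d by (fastforce simp: qcoeff_def xdeg_xmon)
  then show ?thesis by (rule finite_subset[OF _ finite_compositions])
qed


section \<open>The tensor square and the coproduct\<close>

text \<open>
  The tensor square is the free module on pairs, modulo the submodule generated by the bilinearity
  relations.
\<close>

inductive_set bilinear_relations :: "('a::comm_ring_1 qsym \<times> 'a qsym \<Rightarrow>\<^sub>0 'a) set" where
  add_left: "Poly_Mapping.single (u + u', v) c - Poly_Mapping.single (u, v) c
    - Poly_Mapping.single (u', v) c \<in> bilinear_relations"
| add_right: "Poly_Mapping.single (u, v + v') c - Poly_Mapping.single (u, v) c
    - Poly_Mapping.single (u, v') c \<in> bilinear_relations"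
| scale_left: "Poly_Mapping.single (k *\<^sub>Q u, v) c - Poly_Mapping.single (u, v) (k * c) \<in> bilinear_relations"
| scale_right: "Poly_Mapping.single (u, k *\<^sub>Q v) c - Poly_Mapping.single (u, v) (k * c) \<in> bilinear_relations"
| zero: "0 \<in> bilinear_relations"
| plus: "x \<in> bilinear_relations \<Longrightarrow> y \<in> bilinear_relations \<Longrightarrow> x + y \<in> bilinear_relations"
| uminus: "x \<in> bilinear_relations \<Longrightarrow> - x \<in> bilinear_relations"

lemma bilinear_relations_minus:
  "x \<in> bilinear_relations \<Longrightarrow> y \<in> bilinear_relations \<Longrightarrow> x - y \<in> bilinear_relations"
  using bilinear_relations.plus[OF _ bilinear_relations.uminus, of x y] by simp

quotient_type (overloaded) 'a qsym_tensor =
  "'a::comm_ring_1 qsym \<times> 'a qsym \<Rightarrow>\<^sub>0 'a" / "\<lambda>x y. x - y \<in> bilinear_relations"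
proof (rule equivpI)
  show "reflp (\<lambda>x y. x - y \<in> bilinear_relations)"
    by (auto simp: reflp_def bilinear_relations.zero)
  show "symp (\<lambda>x y. x - y \<in> bilinear_relations)"
    by (auto simp: symp_def dest: bilinear_relations.uminus)
  show "transp (\<lambda>x y. x - y \<in> bilinear_relations)"
    by (auto simp: transp_def dest: bilinear_relations.plus)
qed

instantiation qsym_tensor :: (comm_ring_1) ab_group_add
begin

lift_definition zero_qsym_tensor :: "'a qsym_tensor" is 0 .

lift_definition plus_qsym_tensor :: "'a qsym_tensor \<Rightarrow> 'a qsym_tensor \<Rightarrow> 'a qsym_tensor" is "(+)"
  using bilinear_relations.plus by (fastforce simp: algebra_simps)

lift_definition minus_qsym_tensor :: "'a qsym_tensor \<Rightarrow> 'a qsym_tensor \<Rightarrow> 'a qsym_tensor" is "(-)"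
  using bilinear_relations_minus by (fastforce simp: algebra_simps)

lift_definition uminus_qsym_tensor :: "'a qsym_tensor \<Rightarrow> 'a qsym_tensor" is uminus
  using bilinear_relations.uminus by (fastforce simp: algebra_simps)

instance
  by standard (transfer; simp add: algebra_simps bilinear_relations.zero)+

end

lemma lookup_map_scale:
  fixes c :: "'a::comm_ring_1"
  shows "Poly_Mapping.lookup (Poly_Mapping.map ((*) c) x) k = c * Poly_Mapping.lookup x k"
  by (simp add: Poly_Mapping.map.rep_eq when_def)

lemma map_scale_simps:
  fixes c :: "'a::comm_ring_1"
  shows "Poly_Mapping.map ((*) c) (x + y) = Poly_Mapping.map ((*) c) x + Poly_Mapping.map ((*) c) y"
    and "Poly_Mapping.map ((*) c) (x - y) = Poly_Mapping.map ((*) c) x - Poly_Mapping.map ((*) c) y"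
    and "Poly_Mapping.map ((*) c) (- x) = - Poly_Mapping.map ((*) c) x"
    and "Poly_Mapping.map ((*) c) 0 = 0"
    and "Poly_Mapping.map ((*) c) (Poly_Mapping.single k d) = Poly_Mapping.single k (c * d)"
  by (rule poly_mapping_eqI;
      simp add: lookup_map_scale lookup_add lookup_minus lookup_single when_def algebra_simps)+

lemma bilinear_relations_scale:
  "x \<in> bilinear_relations \<Longrightarrow> Poly_Mapping.map ((*) c) x \<in> bilinear_relations"
proof (induction rule: bilinear_relations.induct)
  case (scale_left k u v d)
  then show ?case using bilinear_relations.scale_left[of k u v "c * d"]
    by (simp add: map_scale_simps mult.left_commute)
next
  case (scale_right u k v d)
  then show ?case using bilinear_relations.scale_right[of u k v "c * d"]
    by (simp add: map_scale_simps mult.left_commute)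
qed (simp_all add: map_scale_simps bilinear_relations.intros)

lift_definition tscale :: "'a::comm_ring_1 \<Rightarrow> 'a qsym_tensor \<Rightarrow> 'a qsym_tensor" (infixr "*\<^sub>T" 75)
  is "\<lambda>c. Poly_Mapping.map ((*) c)"
  using bilinear_relations_scale by (metis map_scale_simps(2))

definition tensor :: "'a::comm_ring_1 qsym \<Rightarrow> 'a qsym \<Rightarrow> 'a qsym_tensor" (infix "\<otimes>\<^sub>Q" 70)
  where "u \<otimes>\<^sub>Q v = abs_qsym_tensor (Poly_Mapping.single (u, v) 1)"

lemma tensor_bilinear:
  "(u + u') \<otimes>\<^sub>Q v = u \<otimes>\<^sub>Q v + u' \<otimes>\<^sub>Q v" "u \<otimes>\<^sub>Q (v + v') = u \<otimes>\<^sub>Q v + u \<otimes>\<^sub>Q v'"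
  "(c *\<^sub>Q u) \<otimes>\<^sub>Q v = c *\<^sub>T (u \<otimes>\<^sub>Q v)" "u \<otimes>\<^sub>Q (c *\<^sub>Q v) = c *\<^sub>T (u \<otimes>\<^sub>Q v)"
  using bilinear_relations.intros(1)[of u u' v 1] bilinear_relations.intros(2)[of u v v' 1]
    bilinear_relations.intros(3)[of c u v 1] bilinear_relations.intros(4)[of u c v 1]
  by (simp_all add: tensor_def plus_qsym_tensor.abs_eq tscale.abs_eq qsym_tensor.abs_eq_iff
      map_scale_simps diff_diff_eq)

lemma tscale_simps:
  "c *\<^sub>T (x + y) = c *\<^sub>T x + c *\<^sub>T y" "(c + d) *\<^sub>T x = c *\<^sub>T x + d *\<^sub>T x"
  "(c * d) *\<^sub>T x = c *\<^sub>T d *\<^sub>T x" "1 *\<^sub>T x = x" "0 *\<^sub>T x = 0" "c *\<^sub>T 0 = 0"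
proof -
  have eq: "x = y \<Longrightarrow> x - y \<in> bilinear_relations" for x y :: "'a qsym \<times> 'a qsym \<Rightarrow>\<^sub>0 'a"
    by (simp add: bilinear_relations.zero)
  note s = lookup_map_scale lookup_add algebra_simps
  show "c *\<^sub>T (x + y) = c *\<^sub>T x + c *\<^sub>T y"
    by transfer (rule eq, rule poly_mapping_eqI, simp add: s)
  show "(c + d) *\<^sub>T x = c *\<^sub>T x + d *\<^sub>T x"
    by transfer (rule eq, rule poly_mapping_eqI, simp add: s)
  show "(c * d) *\<^sub>T x = c *\<^sub>T d *\<^sub>T x"
    by transfer (rule eq, rule poly_mapping_eqI, simp add: s)
  show "1 *\<^sub>T x = x"
    by transfer (rule eq, rule poly_mapping_eqI, simp add: s)
  show "0 *\<^sub>T x = 0"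
    by transfer (rule eq, rule poly_mapping_eqI, simp add: s)
  show "c *\<^sub>T 0 = (0 :: 'a qsym_tensor)"
    by transfer (rule eq, rule poly_mapping_eqI, simp add: s)
qed

text \<open>
  The linear extension of the rule in \<open>coproduct_QM\<close> below; the outer sum is finite by \<open>finite_qcoeff\<close>.
\<close>

definition coproduct :: "'a::comm_ring_1 qsym \<Rightarrow> 'a qsym_tensor" ("\<triangle>") where
  "\<triangle> f = (\<Sum>\<alpha> | composition \<alpha> \<and> qcoeff f \<alpha> \<noteq> 0.
     qcoeff f \<alpha> *\<^sub>T (\<Sum>(\<beta>, \<gamma>) | \<beta> @ \<gamma> = \<alpha>. QM \<beta> \<otimes>\<^sub>Q QM \<gamma>))"

lemma coproduct_QM:
  assumes "composition \<alpha>"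
  shows "\<triangle> (QM \<alpha>) = (\<Sum>(\<beta>, \<gamma>) | \<beta> @ \<gamma> = \<alpha>. QM \<beta> \<otimes>\<^sub>Q QM \<gamma>)"
proof -
  have "{\<beta>. composition \<beta> \<and> qcoeff (QM \<alpha> :: 'a qsym) \<beta> \<noteq> 0} = {\<alpha>}"
    using assms by (auto simp: qcoeff_QM split: if_splits)
  then show ?thesis using assms by (simp add: coproduct_def qcoeff_QM tscale_simps)
qed

lemma coproduct_superset:
  assumes "finite S" "{\<alpha>. composition \<alpha> \<and> qcoeff f \<alpha> \<noteq> 0} \<subseteq> S" "\<And>\<alpha>. \<alpha> \<in> S \<Longrightarrow> composition \<alpha>"
  shows "\<triangle> f = (\<Sum>\<alpha>\<in>S. qcoeff f \<alpha> *\<^sub>T (\<Sum>(\<beta>, \<gamma>) | \<beta> @ \<gamma> = \<alpha>. QM \<beta> \<otimes>\<^sub>Q QM \<gamma>))"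
  unfolding coproduct_def using assms
  by (intro sum.mono_neutral_left) (auto simp: tscale_simps)

lemma coproduct_add: "\<triangle> (f + g) = \<triangle> f + \<triangle> g"
proof -
  let ?S = "{\<alpha>. composition \<alpha> \<and> qcoeff f \<alpha> \<noteq> 0} \<union> {\<alpha>. composition \<alpha> \<and> qcoeff g \<alpha> \<noteq> 0}"
  have "finite ?S" by (simp add: finite_qcoeff)
  then show ?thesis
    by (subst (1 2 3) coproduct_superset[of ?S])
       (auto simp: qcoeff_add tscale_simps sum.distrib)
qed

lemma tscale_sum: "c *\<^sub>T (\<Sum>i\<in>S. x i) = (\<Sum>i\<in>S. c *\<^sub>T x i)"
  by (induction S rule: infinite_finite_induct) (auto simp: tscale_simps)

lemma coproduct_scale: "\<triangle> (c *\<^sub>Q f) = c *\<^sub>T \<triangle> f"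
proof -
  let ?S = "{\<alpha>. composition \<alpha> \<and> qcoeff f \<alpha> \<noteq> 0}"
  have "\<triangle> (c *\<^sub>Q f) = (\<Sum>\<alpha>\<in>?S. qcoeff (c *\<^sub>Q f) \<alpha> *\<^sub>T
      (\<Sum>(\<beta>, \<gamma>) | \<beta> @ \<gamma> = \<alpha>. QM \<beta> \<otimes>\<^sub>Q QM \<gamma>))"
    by (rule coproduct_superset) (auto simp: qcoeff_scale finite_qcoeff)
  then show ?thesis
    by (simp add: coproduct_def qcoeff_scale tscale_simps(3) tscale_sum)
qed


section \<open>Subset operations\<close>

text \<open>The \<open>i\<close>-th smallest element of \<open>A\<close>, counting from 1.\<close>

definition kth :: "nat set \<Rightarrow> nat \<Rightarrow> nat" where
  "kth A i = sorted_list_of_set A ! (i - 1)"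

text \<open>In the following, \<open>N\<close> is the size of the ambient set \<open>{1..N}\<close> and \<open>A \<subseteq> {1..N}\<close>.\<close>

definition ends :: "nat \<Rightarrow> nat set \<Rightarrow> nat set" where
  "ends N A = {i \<in> {1..N - 1}. i \<in> A \<and> i + 1 \<notin> A}"

definition all_ends :: "nat \<Rightarrow> nat set \<Rightarrow> nat set" where
  "all_ends N A = ends N A \<union> ends N ({1..N} - A)"

definition hash :: "nat \<Rightarrow> nat set \<Rightarrow> nat set \<Rightarrow> nat set \<Rightarrow> nat set" where
  "hash N A I J = kth ({1..N} - A) ` I \<union> kth A ` J"

definition shuffle :: "nat \<Rightarrow> nat set \<Rightarrow> nat set \<Rightarrow> nat set \<Rightarrow> nat set" where
  "shuffle N A I J = ends N A \<union> (hash N A I J - all_ends N A)"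


section \<open>The field of rational functions and the two exponents\<close>

definition qvar :: "complex poly fract" where
  "qvar = Fract [:0, 1:] 1"

text \<open>
  The subtraction is truncated. The largest element of \<open>all_ends N A\<close> is never in \<open>hash N A I J\<close>, so this
  only matters when \<open>all_ends N A\<close> is empty, that is, when one of the two factors of the product has
  degree 0 and is therefore the unit; the exponent is then 0, not \<open>-1\<close>.
\<close>

definition product_exponent :: "nat \<Rightarrow> nat set \<Rightarrow> nat set \<Rightarrow> nat set \<Rightarrow> nat" where
  "product_exponent N A I J = card (all_ends N A - hash N A I J) - 1"

text \<open>
  The exponent is 0 on the concatenations, as \<open>q = 1\<close> forces: there \<open>QMq 1 \<alpha> = QM \<alpha>\<close>, whose coproduct
  is deconcatenation. The reverse assignment (0 on the near-concatenations, 1 otherwise) already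
  fails for the composition \<open>[1, 1]\<close>.
\<close>

definition coproduct_exponent :: "nat list \<Rightarrow> nat list \<Rightarrow> nat list \<Rightarrow> nat" where
  "coproduct_exponent \<gamma> \<alpha> \<beta> = (if \<alpha> @ \<beta> = \<gamma> then 0 else 1)"

end

theory Submission
  imports Defs
begin

text \<open>
  Put \<open>p = 1 - q\<close>. The definitions of \<open>L\<close> and of \<open>M(q)\<close> are sums over refinements, hence over sets of partial
  sums, and the binomial theorem merges the two into one sign-free expansion:
  \<open>M\<^sub>\<alpha>(q)\<close> is the sum of \<open>p ^ (length \<delta> - length \<alpha>) * M\<^sub>\<delta>\<close> over the refinements \<open>\<delta>\<close> of \<open>\<alpha>\<close>
  (\<open>QMq_eq_sum_QM\<close>). Both formulas follow by comparing coefficients.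

  For the coproduct (\<open>coproduct_QMq\<close>), deconcatenation cuts a refinement \<open>\<delta>\<close> of \<open>\<gamma>\<close> in two. The cut either
  respects the parts of \<open>\<gamma>\<close>, which gives a concatenation, or goes through one of them, which gives a
  near-concatenation and one more power of \<open>p\<close>, since \<open>\<gamma>\<close> then has one part less than its two
  pieces together.

  For the product (\<open>product_QMq\<close>), let \<open>m, n > 0\<close> and fix a composition \<open>\<delta>\<close> of \<open>N = m + n\<close>, with set \<open>D\<close> of
  partial sums including \<open>0\<close> and \<open>N\<close>. It cuts \<open>{1..N}\<close> into blocks. A term of the Cauchy product at
  \<open>\<delta>\<close> distributes each exponent \<open>\<delta>\<^sub>j\<close> over the two factors as \<open>\<beta>\<^sub>j + (\<delta>\<^sub>j - \<beta>\<^sub>j)\<close>. Record it as the set \<open>A\<close>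
  that consists, in the \<open>j\<close>-th block, of all but the first \<open>\<beta>\<^sub>j\<close> elements. The sets so
  obtained are those with \<open>ends N A \<subseteq> D\<close> (\<open>block_final_ex1\<close>). Let \<open>E = D \<union> all_ends N A\<close>. The elements of
  \<open>E\<close> in \<open>{1..N} - A\<close> and in \<open>A\<close>, counted by their ranks there, are the nonzero partial sums of \<open>\<beta>\<close> and
  of \<open>\<delta> - \<beta>\<close> (\<open>rank_image_cuts\<close>). So the term is nonzero only if the set \<open>hash N A I J\<close>, to which the same
  ranking takes \<open>I\<close> and \<open>J\<close> back, is contained in \<open>E\<close>, and it is then \<open>p ^ (card E - 3 - card I - card J)\<close>
  (\<open>qcoeff_mult_block_counts\<close>).

  On the other side, the summand of an arbitrary \<open>A\<close> contributes a sum over \<open>S\<close> in which every available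
  point carries weight \<open>q\<close> or \<open>p\<close> according to whether it is in \<open>S\<close>. As \<open>q + p = 1\<close>, this sum collapses
  to a single power of \<open>p\<close> (\<open>sum_over_extra_cuts\<close>), it is zero unless \<open>ends N A \<subseteq> D\<close> and
  \<open>hash N A I J \<subseteq> E\<close>, and a count of elements shows that the exponent is the same as before
  (\<open>exponent_identity\<close>, \<open>qcoeff_shuffle_term\<close>).
\<close>

section \<open>Coefficients of quasisymmetric functions\<close>

text \<open>
  A quasisymmetric function does not see where the variables of a monomial sit, even if some of
  the listed exponents vanish. Hence \<open>qcoeff f\<close> makes sense, and is used below, on lists with zero
  entries as well: such lists are what the factors of a monomial look like in a product.
\<close>

lemma Rep_qsym_xmon:
  assumes "sorted_wrt (<) ks" "length ks = length \<alpha>"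
  shows "Rep_qsym f (xmon ks \<alpha>) = qcoeff f \<alpha>"
  unfolding qcoeff_def
  by (rule quasisymmetric_weak) (use Rep_qsym[of f] assms in \<open>auto simp: sorted_wrt_upt\<close>)

lemma qsym_eqI:
  assumes "\<And>\<alpha>. composition \<alpha> \<Longrightarrow> qcoeff f \<alpha> = qcoeff g \<alpha>"
  shows "f = g"
proof -
  have "Rep_qsym f m = Rep_qsym g m" for m
  proof -
    define ks where "ks = sorted_list_of_set (Poly_Mapping.keys m)"
    define \<alpha> where "\<alpha> = map (Poly_Mapping.lookup m) ks"
    have ks: "sorted_wrt (<) ks" "set ks = Poly_Mapping.keys m" by (simp_all add: ks_def)
    have len: "length ks = length \<alpha>" by (simp add: \<alpha>_def)
    have comp: "composition \<alpha>"
      using ks(2) by (auto simp: composition_def \<alpha>_def in_keys_iff)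
    have "m = xmon ks \<alpha>"
    proof (rule poly_mapping_eqI)
      fix k
      show "Poly_Mapping.lookup m k = Poly_Mapping.lookup (xmon ks \<alpha>) k"
      proof (cases "k \<in> set ks")
        case True
        then obtain j where "j < length ks" "k = ks ! j" by (auto simp: in_set_conv_nth)
        then show ?thesis
          using lookup_xmon_nth[OF strict_sorted_distinct[OF ks(1)] len] by (simp add: \<alpha>_def)
      next
        case False
        then show ?thesis using ks(2) by (simp add: lookup_xmon_notin in_keys_iff)
      qed
    qed
    then show ?thesis using assms[OF comp] Rep_qsym_xmon[OF ks(1) len] by metis
  qed
  then show ?thesis by (simp add: Rep_qsym_inject[symmetric] fun_eq_iff)
qed

lemma qcoeff_0: "qcoeff 0 \<alpha> = 0"
  by (simp add: qcoeff_def zero_qsym.rep_eq)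

lemma qcoeff_sum: "qcoeff (\<Sum>i\<in>S. f i) \<alpha> = (\<Sum>i\<in>S. qcoeff (f i) \<alpha>)"
  by (induction S rule: infinite_finite_induct) (auto simp: qcoeff_0 qcoeff_add)

lemma qcoeff_filter_nonzero: "qcoeff f (filter (\<lambda>a. a \<noteq> 0) \<beta>) = qcoeff f \<beta>"
proof -
  let ?ks = "map fst (filter (\<lambda>(i, a). a \<noteq> 0) (zip [0..<length \<beta>] \<beta>))"
  let ?\<alpha> = "filter (\<lambda>a. a \<noteq> 0) \<beta>"
  have "sorted_wrt (<) (map fst (zip [0..<length \<beta>] \<beta>))" by (simp add: sorted_wrt_upt)
  then have srt: "sorted_wrt (<) ?ks"
    unfolding sorted_wrt_map by (rule sorted_wrt_filter)
  have "length (filter (\<lambda>(i, a). a \<noteq> 0) (zip xs \<beta>)) = length ?\<alpha>" if "length xs = length \<beta>" for xs :: "nat list"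
    using that by (induction xs \<beta> rule: list_induct2) auto
  then have len: "length ?ks = length ?\<alpha>" by simp
  have "xmon [0..<length \<beta>] \<beta> = xmon ?ks ?\<alpha>" by (rule xmon_drop_zeros) simp
  then show ?thesis
    using Rep_qsym_xmon[OF srt len, of f] Rep_qsym_xmon[of "[0..<length \<beta>]" \<beta> f]
    by (simp add: sorted_wrt_upt)
qed

text \<open>
  The Cauchy product in coefficients: the monomial with exponent list \<open>\<delta>\<close> splits in all ways into
  two monomials in the same variables, with exponent lists \<open>\<beta>\<close> and \<open>\<delta> - \<beta>\<close>.
\<close>

lemma qcoeff_mult:
  "qcoeff (f * g) \<delta> =
    (\<Sum>\<beta> | length \<beta> = length \<delta> \<and> (\<forall>j<length \<delta>. \<beta> ! j \<le> \<delta> ! j).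
       qcoeff f \<beta> * qcoeff g (map2 (-) \<delta> \<beta>))"
  unfolding qcoeff_def times_qsym.rep_eq
  by (subst cauchy_prod_xmon) (auto simp: sorted_wrt_upt intro!: sum.cong)

section \<open>Partial sums and refinement\<close>

text \<open>
  The end points \<open>0\<close> and \<open>sum_list \<beta>\<close> are counted as partial sums, so that the empty composition, zero
  entries and concatenation need no special cases.
\<close>

primrec psums :: "nat list \<Rightarrow> nat set" where
  "psums [] = {0}"
| "psums (b # \<beta>) = insert 0 ((+) b ` psums \<beta>)"

lemma finite_psums [simp]: "finite (psums \<beta>)"
  by (induction \<beta>) auto

lemma zero_in_psums [simp]: "0 \<in> psums \<beta>"
  by (cases \<beta>) auto

lemma sum_list_in_psums [simp]: "sum_list \<beta> \<in> psums \<beta>"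
  by (induction \<beta>) auto

lemma psums_le: "x \<in> psums \<beta> \<Longrightarrow> x \<le> sum_list \<beta>"
  by (induction \<beta> arbitrary: x) auto

lemma psums_append: "psums (\<beta> @ \<beta>') = psums \<beta> \<union> (+) (sum_list \<beta>) ` psums \<beta>'"
  by (induction \<beta>) (auto simp: image_image image_Un add.assoc insert_absorb)

lemma psums_conv_take: "psums \<beta> = (\<lambda>j. sum_list (take j \<beta>)) ` {..length \<beta>}"
proof (induction \<beta>)
  case (Cons b \<beta>)
  then show ?case
    by (simp add: atMost_Suc_eq_insert_0 image_image)
qed simp

lemma psums_filter_nonzero: "psums (filter (\<lambda>a. a \<noteq> 0) \<beta>) = psums \<beta>"
  by (induction \<beta>) (auto simp: insert_absorb)

lemma card_psums: "composition \<alpha> \<Longrightarrow> card (psums \<alpha>) = Suc (length \<alpha>)"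
proof (induction \<alpha>)
  case (Cons a \<alpha>)
  then have "0 \<notin> (+) a ` psums \<alpha>" by (auto simp: composition_def)
  with Cons show ?case by (simp add: composition_def card_image)
qed simp

lemma psums_inject:
  "composition \<alpha> \<Longrightarrow> composition \<beta> \<Longrightarrow> psums \<alpha> = psums \<beta> \<Longrightarrow> \<alpha> = \<beta>"
proof (induction \<alpha> arbitrary: \<beta>)
  case Nil
  then have "psums \<beta> = {0}" by simp
  then have "length \<beta> = 0" using card_psums[OF Nil.prems(2)] by simp
  then show ?case by simp
next
  case (Cons a \<alpha>)
  then have "length \<beta> = Suc (length \<alpha>)" using card_psums[of \<beta>] card_psums[of "a # \<alpha>"] by simp
  then obtain b \<gamma> where \<beta>: "\<beta> = b # \<gamma>" by (cases \<beta>) auto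
  have pos: "0 < a" "0 < b" using Cons.prems \<beta> by (auto simp: composition_def)
  have tails: "(+) a ` psums \<alpha> = (+) b ` psums \<gamma>"
  proof -
    have "0 \<notin> (+) a ` psums \<alpha>" "0 \<notin> (+) b ` psums \<gamma>" using pos by auto
    then show ?thesis using Cons.prems(3) \<beta> by (simp add: insert_ident)
  qed
  have "a \<in> (+) a ` psums \<alpha>" "b \<in> (+) b ` psums \<gamma>" by (auto intro: image_eqI[of _ _ 0])
  then have "a = b" using tails by (metis antisym imageE le_add1)
  then have "psums \<alpha> = psums \<gamma>" using tails by (metis inj_image_eq_iff inj_on_add)
  then show ?case using Cons \<beta> \<open>a = b\<close> by (simp add: composition_def)
qed

lemma refines_Nil_iff: "refines \<beta> [] \<longleftrightarrow> \<beta> = []"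
  by (auto simp: refines_def)

lemma refines_Cons_iff:
  "refines \<beta> (a # \<alpha>) \<longleftrightarrow> (\<exists>b \<beta>'. b \<noteq> [] \<and> \<beta> = b @ \<beta>' \<and> sum_list b = a \<and> refines \<beta>' \<alpha>)"
proof
  assume "refines \<beta> (a # \<alpha>)"
  then show "\<exists>b \<beta>'. b \<noteq> [] \<and> \<beta> = b @ \<beta>' \<and> sum_list b = a \<and> refines \<beta>' \<alpha>"
    unfolding refines_def by (fastforce simp: map_eq_Cons_conv)
next
  assume "\<exists>b \<beta>'. b \<noteq> [] \<and> \<beta> = b @ \<beta>' \<and> sum_list b = a \<and> refines \<beta>' \<alpha>"
  then obtain b bs where "b \<noteq> []" "\<forall>b\<in>set bs. b \<noteq> []" "\<beta> = b @ concat bs" "sum_list b = a"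
    "map sum_list bs = \<alpha>" unfolding refines_def by auto
  then show "refines \<beta> (a # \<alpha>)" unfolding refines_def by (intro exI[of _ "b # bs"]) auto
qed

text \<open>
  Adding together adjacent parts of \<open>\<beta>\<close> erases partial sums and creates none; conversely a set of
  partial sums that is contained in \<open>psums \<beta>\<close> tells where \<open>\<beta>\<close> has to be cut into the groups to be added.
\<close>

lemma refines_iff_psums:
  assumes "composition \<alpha>" "composition \<beta>"
  shows "refines \<beta> \<alpha> \<longleftrightarrow> sum_list \<beta> = sum_list \<alpha> \<and> psums \<alpha> \<subseteq> psums \<beta>"
  using assms
proof (induction \<alpha> arbitrary: \<beta>)
  case Nil
  then show ?case by (cases \<beta>) (auto simp: refines_Nil_iff composition_def)
next
  case (Cons a \<alpha>)
  have pos: "0 < a" "composition \<alpha>" using Cons.prems by (auto simp: composition_def)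
  show ?case
  proof
    assume "refines \<beta> (a # \<alpha>)"
    then obtain b \<beta>' where b: "\<beta> = b @ \<beta>'" "sum_list b = a" "refines \<beta>' \<alpha>"
      by (auto simp: refines_Cons_iff)
    have "composition \<beta>'" using Cons.prems b by (auto simp: composition_def)
    then show "sum_list \<beta> = sum_list (a # \<alpha>) \<and> psums (a # \<alpha>) \<subseteq> psums \<beta>"
      using Cons.IH[OF pos(2)] b by (auto simp: psums_append)
  next
    assume R: "sum_list \<beta> = sum_list (a # \<alpha>) \<and> psums (a # \<alpha>) \<subseteq> psums \<beta>"
    then have "a \<in> psums \<beta>" by (auto intro: image_eqI[of _ _ 0])
    then obtain j where j: "a = sum_list (take j \<beta>)" by (auto simp: psums_conv_take)
    let ?b = "take j \<beta>" and ?\<beta>' = "drop j \<beta>"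
    have split: "psums \<beta> = psums ?b \<union> (+) a ` psums ?\<beta>'"
      using psums_append[of ?b ?\<beta>'] j by simp
    have "psums \<alpha> \<subseteq> psums ?\<beta>'"
    proof
      fix y assume "y \<in> psums \<alpha>"
      then have "a + y \<in> psums ?b \<union> (+) a ` psums ?\<beta>'" using R split by auto
      then show "y \<in> psums ?\<beta>'" using psums_le[of "a + y" ?b] j by (cases "y = 0") auto
    qed
    moreover have "sum_list ?\<beta>' = sum_list \<alpha>"
      using R j by (metis add_left_cancel append_take_drop_id sum_list.Cons sum_list_append)
    moreover have "composition ?\<beta>'"
      using Cons.prems(2) by (auto simp: composition_def dest: in_set_dropD)
    ultimately have "refines ?\<beta>' \<alpha>" using Cons.IH[OF pos(2)] by blast
    moreover have "?b \<noteq> []" using j pos by (cases "?b = []") simp_all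
    ultimately show "refines \<beta> (a # \<alpha>)" unfolding refines_Cons_iff using j
      by (intro exI[of _ ?b] exI[of _ ?\<beta>']) simp
  qed
qed

text \<open>
  The parts of \<open>comp_of n I\<close> are the gaps between consecutive elements of \<open>I \<union> {0, n}\<close>, so the partial
  sums recover \<open>I \<union> {0, n}\<close>. The induction starts the list of gaps at an arbitrary point \<open>s\<close>.
\<close>

lemma comp_of_properties:
  assumes "I \<subseteq> {1..n - 1}"
  shows composition_comp_of: "composition (comp_of n I)"
    and sum_list_comp_of: "sum_list (comp_of n I) = n"
    and psums_comp_of: "psums (comp_of n I) = insert 0 (insert n I)"
proof -
  have gaps: "composition (map2 (\<lambda>t s. t - s) (l @ [n]) (s # l)) \<and>
      sum_list (map2 (\<lambda>t s. t - s) (l @ [n]) (s # l)) = n - s \<and>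
      psums (map2 (\<lambda>t s. t - s) (l @ [n]) (s # l)) = (\<lambda>x. x - s) ` insert s (insert n (set l))"
    if "sorted_wrt (<) (s # l @ [n])" for s l
    using that
  proof (induction l arbitrary: s)
    case Nil
    then show ?case by (simp add: composition_def)
  next
    case (Cons x l)
    let ?g = "map2 (\<lambda>t s. t - s) (l @ [n]) (x # l)"
    have lt: "s < x" "x < n" "\<forall>y\<in>set l. x < y" using Cons.prems by auto
    have IH: "composition ?g" "sum_list ?g = n - x"
      "psums ?g = (\<lambda>y. y - x) ` insert x (insert n (set l))"
      using Cons.IH[of x] Cons.prems by auto
    have "(+) (x - s) ` psums ?g = (\<lambda>y. y - s) ` insert x (insert n (set l))"
      unfolding IH(3) image_image by (rule image_cong[OF refl]) (use lt in auto)
    then show ?case using lt IH(1,2) by (simp add: composition_def insert_commute)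
  qed
  have fin: "finite I" using assms finite_subset by blast
  have "composition (comp_of n I) \<and> sum_list (comp_of n I) = n \<and>
    psums (comp_of n I) = insert 0 (insert n I)"
  proof (cases "n = 0")
    case True
    then have "I = {}" using assms by auto
    then show ?thesis using True by (simp add: comp_of_def composition_def)
  next
    case False
    have "0 < x \<and> x < n" if "x \<in> I" for x
      using subsetD[OF assms that] False by auto
    then have "sorted_wrt (<) (0 # sorted_list_of_set I @ [n])"
      using False fin by (simp add: sorted_wrt_append)
    from gaps[OF this] show ?thesis using False fin by (simp add: comp_of_def)
  qed
  then show "composition (comp_of n I)" "sum_list (comp_of n I) = n"
    "psums (comp_of n I) = insert 0 (insert n I)" by auto
qed

section \<open>The expansion in monomial quasisymmetric functions\<close>

lemma qcoeff_QL:
  assumes "composition \<delta>"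
  shows "qcoeff (QL \<beta>) \<delta> = (if refines \<delta> \<beta> then 1 else 0)"
proof -
  have "qcoeff (QL \<beta> :: 'a qsym) \<delta> =
      (\<Sum>\<epsilon> | composition \<epsilon> \<and> refines \<epsilon> \<beta>. if \<delta> = \<epsilon> then 1 else 0)"
    unfolding QL_def qcoeff_sum using assms by (intro sum.cong refl) (simp add: qcoeff_QM)
  then show ?thesis using assms finite_refinements[of \<beta>] by simp
qed

lemma sum_power_card_subsets:
  fixes x :: "'a::comm_ring_1"
  assumes "finite X"
  shows "(\<Sum>K | K \<subseteq> X. x ^ card K * y ^ card (X - K)) = (x + y) ^ card X"
  using prod_add[OF assms, of "\<lambda>_. x" "\<lambda>_. y"] by (simp add: Pow_def)

text \<open>
  A composition between \<open>\<alpha>\<close> and \<open>\<delta>\<close> in the refinement order amounts to a subset \<open>K\<close> of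
  \<open>psums \<delta> - psums \<alpha>\<close>, and contributes \<open>(- q) ^ card K\<close>. The binomial theorem sums these to a
  power of \<open>1 - q\<close>.
\<close>

lemma qcoeff_QMq_composition:
  assumes \<alpha>: "composition \<alpha>" and \<delta>: "composition \<delta>"
  shows "qcoeff (QMq q \<alpha>) \<delta> =
    (if refines \<delta> \<alpha> then (1 - q) ^ card (psums \<delta> - psums \<alpha>) else 0)"
proof -
  define R where "R = {\<beta>. composition \<beta> \<and> refines \<beta> \<alpha> \<and> refines \<delta> \<beta>}"
  have R: "\<beta> \<in> R \<longleftrightarrow> composition \<beta> \<and> sum_list \<beta> = sum_list \<alpha> \<and> sum_list \<delta> = sum_list \<alpha> \<and>
      psums \<alpha> \<subseteq> psums \<beta> \<and> psums \<beta> \<subseteq> psums \<delta>" for \<beta>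
    using \<alpha> \<delta> unfolding R_def by (auto simp: refines_iff_psums)
  have "qcoeff (QMq q \<alpha>) \<delta> = (\<Sum>\<beta> | composition \<beta> \<and> refines \<beta> \<alpha>.
      if refines \<delta> \<beta> then (- q) ^ (length \<beta> - length \<alpha>) else 0)"
    unfolding QMq_def qcoeff_sum by (intro sum.cong refl) (simp add: qcoeff_scale qcoeff_QL \<delta>)
  also have "\<dots> = (\<Sum>\<beta>\<in>R. (- q) ^ (length \<beta> - length \<alpha>))"
    by (rule sum.mono_neutral_cong_right[OF finite_refinements]) (auto simp: R_def)
  also have "\<dots> = (\<Sum>\<beta>\<in>R. (- q) ^ card (psums \<beta> - psums \<alpha>))"
  proof (intro sum.cong refl)
    fix \<beta> assume "\<beta> \<in> R"
    then have "card (psums \<beta> - psums \<alpha>) = length \<beta> - length \<alpha>"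
      using \<alpha> by (simp add: R card_Diff_subset card_psums)
    then show "(- q) ^ (length \<beta> - length \<alpha>) = (- q) ^ card (psums \<beta> - psums \<alpha>)" by simp
  qed
  also have "\<dots> = (if refines \<delta> \<alpha> then (1 - q) ^ card (psums \<delta> - psums \<alpha>) else 0)"
  proof (cases "refines \<delta> \<alpha>")
    case False
    have "R = {}"
    proof (rule ccontr)
      assume "R \<noteq> {}"
      then obtain \<beta> where "\<beta> \<in> R" by blast
      then have "refines \<delta> \<alpha>"
        unfolding R refines_iff_psums[OF \<alpha> \<delta>] by (meson order_trans)
      then show False using False by blast
    qed
    then show ?thesis using False by simp
  next
    case True
    let ?X = "psums \<delta> - psums \<alpha>" and ?n = "sum_list \<alpha>"
    have sub: "psums \<alpha> \<subseteq> psums \<delta>" "sum_list \<delta> = ?n" using True \<alpha> \<delta> by (auto simp: refines_iff_psums)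
    have "bij_betw (\<lambda>\<beta>. psums \<beta> - psums \<alpha>) R {K. K \<subseteq> ?X}"
    proof (rule bij_betw_imageI)
      show "inj_on (\<lambda>\<beta>. psums \<beta> - psums \<alpha>) R"
      proof (rule inj_onI)
        fix \<beta> \<gamma> assume b: "\<beta> \<in> R" "\<gamma> \<in> R" "psums \<beta> - psums \<alpha> = psums \<gamma> - psums \<alpha>"
        then have "psums \<beta> = psums \<gamma>" by (auto simp: R)
        then show "\<beta> = \<gamma>" using b psums_inject by (auto simp: R)
      qed
      show "(\<lambda>\<beta>. psums \<beta> - psums \<alpha>) ` R = {K. K \<subseteq> ?X}"
      proof (intro equalityI subsetI)
        fix K assume K: "K \<in> {K. K \<subseteq> ?X}"
        define G where "G = psums \<alpha> \<union> K"
        have "G \<subseteq> psums \<delta>" using K sub by (auto simp: G_def)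
        then have "\<forall>x\<in>G. x \<le> ?n" using psums_le[of _ \<delta>] sub by auto
        then have I: "G - {0, ?n} \<subseteq> {1..?n - 1}" by fastforce
        have "psums (comp_of ?n (G - {0, ?n})) = G"
          using I by (auto simp: psums_comp_of G_def)
        moreover have "comp_of ?n (G - {0, ?n}) \<in> R"
          unfolding R using I \<open>G \<subseteq> psums \<delta>\<close> sub(2) calculation
          by (auto simp: composition_comp_of sum_list_comp_of G_def)
        moreover have "K = G - psums \<alpha>" using K by (auto simp: G_def)
        ultimately show "K \<in> (\<lambda>\<beta>. psums \<beta> - psums \<alpha>) ` R" by (metis imageI)
      next
        fix K assume "K \<in> (\<lambda>\<beta>. psums \<beta> - psums \<alpha>) ` R"
        then show "K \<in> {K. K \<subseteq> ?X}" by (auto simp only: R)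
      qed
    qed
    then have "(\<Sum>\<beta>\<in>R. (- q) ^ card (psums \<beta> - psums \<alpha>)) = (\<Sum>K | K \<subseteq> ?X. (- q) ^ card K)"
      by (rule sum.reindex_bij_betw)
    also have "\<dots> = (1 - q) ^ card ?X"
      using sum_power_card_subsets[of ?X "- q" 1] by simp
    finally show ?thesis using True by simp
  qed
  finally show ?thesis .
qed

lemma qcoeff_QMq:
  assumes "composition \<alpha>"
  shows "qcoeff (QMq q \<alpha>) \<beta> =
    (if sum_list \<beta> = sum_list \<alpha> \<and> psums \<alpha> \<subseteq> psums \<beta>
     then (1 - q) ^ card (psums \<beta> - psums \<alpha>) else 0)"
proof -
  let ?\<delta> = "filter (\<lambda>a. a \<noteq> 0) \<beta>"
  have \<delta>: "composition ?\<delta>" by (auto simp: composition_def)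
  have "sum_list ?\<delta> = sum_list \<beta>" by (induction \<beta>) auto
  then show ?thesis
    using qcoeff_QMq_composition[OF assms \<delta>, of q] assms \<delta>
    unfolding qcoeff_filter_nonzero refines_iff_psums[OF assms \<delta>] psums_filter_nonzero by simp
qed

text \<open>
  The coproduct formula is read off from this sign-free expansion; the product formula uses its
  coefficients, in the form \<open>qcoeff_QMq\<close>.
\<close>

lemma QMq_eq_sum_QM:
  assumes "composition \<gamma>"
  shows "QMq q \<gamma> =
    (\<Sum>\<delta> | composition \<delta> \<and> refines \<delta> \<gamma>. (1 - q) ^ (length \<delta> - length \<gamma>) *\<^sub>Q QM \<delta>)"
proof (rule qsym_eqI)
  fix \<epsilon> assume \<epsilon>: "composition \<epsilon>"
  have "qcoeff (\<Sum>\<delta> | composition \<delta> \<and> refines \<delta> \<gamma>. (1 - q) ^ (length \<delta> - length \<gamma>) *\<^sub>Q QM \<delta>) \<epsilon> =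
    (\<Sum>\<delta> | composition \<delta> \<and> refines \<delta> \<gamma>. if \<epsilon> = \<delta> then (1 - q) ^ (length \<delta> - length \<gamma>) else 0)"
    unfolding qcoeff_sum by (intro sum.cong refl) (simp add: qcoeff_scale qcoeff_QM \<epsilon>)
  also have "\<dots> = (if refines \<epsilon> \<gamma> then (1 - q) ^ (length \<epsilon> - length \<gamma>) else 0)"
    using \<epsilon> by (simp add: finite_refinements)
  also have "\<dots> = (if refines \<epsilon> \<gamma> then (1 - q) ^ card (psums \<epsilon> - psums \<gamma>) else 0)"
    using assms \<epsilon> by (auto simp: card_Diff_subset card_psums refines_iff_psums)
  finally show "qcoeff (QMq q \<gamma>) \<epsilon> = qcoeff (\<Sum>\<delta> | composition \<delta> \<and> refines \<delta> \<gamma>.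
      (1 - q) ^ (length \<delta> - length \<gamma>) *\<^sub>Q QM \<delta>) \<epsilon>"
    using qcoeff_QMq_composition[OF assms \<epsilon>, of q] by simp
qed

section \<open>The coproduct\<close>

lemma near_concat_Nil [simp]: "[] \<odot> \<beta> = \<beta>" "\<alpha> \<odot> [] = \<alpha>"
  by (auto simp: near_concat_def)

lemma near_concat_singleton [simp]: "[a] \<odot> (b # \<beta>) = (a + b) # \<beta>"
  by (simp add: near_concat_def)

lemma near_concat_Cons [simp]: "\<alpha> \<noteq> [] \<Longrightarrow> (a # \<alpha>) \<odot> \<beta> = a # (\<alpha> \<odot> \<beta>)"
  by (simp add: near_concat_def)

lemma sum_list_near_concat: "sum_list (\<alpha> \<odot> \<beta>) = sum_list \<alpha> + sum_list \<beta>"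
proof (induction \<alpha>)
  case (Cons a \<alpha>)
  then show ?case by (cases "\<alpha> = []"; cases \<beta>) auto
qed simp

lemma length_near_concat:
  "\<alpha> \<noteq> [] \<Longrightarrow> \<beta> \<noteq> [] \<Longrightarrow> Suc (length (\<alpha> \<odot> \<beta>)) = length \<alpha> + length \<beta>"
  by (cases \<beta>) (auto simp: near_concat_def)

lemma composition_append [simp]: "composition (\<alpha> @ \<beta>) \<longleftrightarrow> composition \<alpha> \<and> composition \<beta>"
  by (auto simp: composition_def)

lemma refines_append:
  "refines \<beta> \<alpha> \<Longrightarrow> refines \<beta>' \<alpha>' \<Longrightarrow> refines (\<beta> @ \<beta>') (\<alpha> @ \<alpha>')"
  unfolding refines_def by (metis concat_append map_append Un_iff set_append)

lemma refines_near_concat: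
  "refines \<beta> \<alpha> \<Longrightarrow> refines \<beta>' \<alpha>' \<Longrightarrow> refines (\<beta> @ \<beta>') (\<alpha> \<odot> \<alpha>')"
proof (induction \<alpha> arbitrary: \<beta>)
  case Nil
  then show ?case by (simp add: refines_Nil_iff)
next
  case (Cons a \<alpha>)
  then obtain b \<epsilon> where b: "b \<noteq> []" "\<beta> = b @ \<epsilon>" "sum_list b = a" "refines \<epsilon> \<alpha>"
    by (auto simp: refines_Cons_iff)
  show ?case
  proof (cases "\<alpha> = []")
    case False
    then have "refines (b @ (\<epsilon> @ \<beta>')) (a # (\<alpha> \<odot> \<alpha>'))"
      unfolding refines_Cons_iff using Cons.IH[OF b(4) Cons.prems(2)] b by blast
    then show ?thesis using False b by simp
  next
    case True
    then have \<beta>: "\<beta> = b" using b by (simp add: refines_Nil_iff)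
    show ?thesis
    proof (cases \<alpha>')
      case Nil
      then show ?thesis using Cons.prems by (simp add: refines_Nil_iff)
    next
      case (Cons c \<gamma>)
      then obtain d \<zeta> where "\<beta>' = d @ \<zeta>" "sum_list d = c" "refines \<zeta> \<gamma>"
        using \<open>refines \<beta>' \<alpha>'\<close> by (auto simp: refines_Cons_iff)
      then have "refines ((b @ d) @ \<zeta>) ((a + c) # \<gamma>)"
        unfolding refines_Cons_iff using b by (intro exI[of _ "b @ d"] exI[of _ \<zeta>]) simp
      then show ?thesis using True Cons \<beta> \<open>\<beta>' = d @ \<zeta>\<close> by simp
    qed
  qed
qed

text \<open>
  A refinement of \<open>\<gamma>\<close> can be cut between any two of its parts. If the cut falls between two groups,
  \<open>\<gamma>\<close> is a concatenation; if it falls inside a group, it splits a part of \<open>\<gamma>\<close> in two, and \<open>\<gamma>\<close> is a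
  near-concatenation.
\<close>

lemma refines_appendE:
  assumes "refines (\<beta> @ \<beta>') \<gamma>"
  obtains \<alpha> \<alpha>' where "\<alpha> @ \<alpha>' = \<gamma> \<or> \<alpha> \<odot> \<alpha>' = \<gamma>" "refines \<beta> \<alpha>" "refines \<beta>' \<alpha>'"
proof -
  have "\<exists>\<alpha> \<alpha>'. (\<alpha> @ \<alpha>' = \<gamma> \<or> \<alpha> \<odot> \<alpha>' = \<gamma>) \<and> refines \<beta> \<alpha> \<and> refines \<beta>' \<alpha>'"
    using assms
  proof (induction \<gamma> arbitrary: \<beta>)
    case Nil
    then show ?case by (intro exI[of _ "[]"]) (auto simp: refines_Nil_iff)
  next
    case (Cons c \<gamma>)
    then obtain b \<epsilon> where b: "b \<noteq> []" "\<beta> @ \<beta>' = b @ \<epsilon>" "sum_list b = c" "refines \<epsilon> \<gamma>"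
      by (auto simp: refines_Cons_iff)
    from b(2) obtain us where "\<beta> = b @ us \<and> us @ \<beta>' = \<epsilon> \<or> \<beta> @ us = b \<and> \<beta>' = us @ \<epsilon>"
      by (auto simp: append_eq_append_conv2)
    then show ?case
    proof
      assume us: "\<beta> = b @ us \<and> us @ \<beta>' = \<epsilon>"
      then obtain \<alpha> \<alpha>' where \<alpha>: "\<alpha> @ \<alpha>' = \<gamma> \<or> \<alpha> \<odot> \<alpha>' = \<gamma>" "refines us \<alpha>" "refines \<beta>' \<alpha>'"
        using Cons.IH[of us] b by auto
      have "(c # \<alpha>) @ \<alpha>' = c # \<gamma> \<or> (c # \<alpha>) \<odot> \<alpha>' = c # \<gamma>" using \<alpha>(1) by (cases "\<alpha> = []") auto
      moreover have "refines \<beta> (c # \<alpha>)" using us b \<alpha>(2) by (auto simp: refines_Cons_iff)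
      ultimately show ?thesis using \<alpha>(3) by blast
    next
      assume us: "\<beta> @ us = b \<and> \<beta>' = us @ \<epsilon>"
      consider "\<beta> = []" | "us = []" | "\<beta> \<noteq> []" "us \<noteq> []" by blast
      then show ?thesis
      proof cases
        case 1
        then have "refines \<beta> []" "refines \<beta>' (c # \<gamma>)"
          using Cons.prems by (auto simp: refines_Nil_iff)
        then show ?thesis by (intro exI[of _ "[]"] exI[of _ "c # \<gamma>"]) simp
      next
        case 2
        then have "refines \<beta> [c]" "refines \<beta>' \<gamma>"
          using us b by (auto simp: refines_Cons_iff refines_Nil_iff)
        then show ?thesis by (intro exI[of _ "[c]"] exI[of _ \<gamma>]) simp
      next
        case 3
        let ?\<alpha> = "[sum_list \<beta>]" and ?\<alpha>' = "sum_list us # \<gamma>"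
        have "refines \<beta> ?\<alpha>" "refines \<beta>' ?\<alpha>'"
          using 3 us b by (auto simp: refines_Cons_iff refines_Nil_iff)
        moreover have "?\<alpha> \<odot> ?\<alpha>' = c # \<gamma>" using us b by auto
        ultimately show ?thesis by blast
      qed
    qed
  qed
  then show ?thesis using that by blast
qed

text \<open>
  For \<open>s \<le> sum_list \<gamma>\<close>, the pieces of \<open>\<gamma>\<close> of sizes \<open>s\<close> and \<open>sum_list \<gamma> - s\<close>. If \<open>s\<close> is a partial sum of \<open>\<gamma>\<close> they
  concatenate to \<open>\<gamma>\<close>, otherwise they near-concatenate to it.
\<close>

fun cut :: "nat \<Rightarrow> nat list \<Rightarrow> nat list \<times> nat list" where
  "cut s [] = ([], [])"
| "cut s (c # \<gamma>) = (if s = 0 then ([], c # \<gamma>) else if s < c then ([s], (c - s) # \<gamma>)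
     else map_prod ((#) c) id (cut (s - c) \<gamma>))"

text \<open>
  The size of the left piece determines a decomposition of either kind; this is what makes the sum
  over \<open>(\<alpha>, \<beta>)\<close> in the coproduct formula a sum without repetitions.
\<close>

lemma cut_unique:
  assumes "composition \<alpha>" "composition \<alpha>'" "\<alpha> @ \<alpha>' = \<gamma> \<or> \<alpha> \<odot> \<alpha>' = \<gamma>"
  shows "cut (sum_list \<alpha>) \<gamma> = (\<alpha>, \<alpha>')"
  using assms
proof (induction \<alpha> arbitrary: \<gamma>)
  case Nil
  then show ?case by (cases \<alpha>') auto
next
  case (Cons a \<alpha>)
  have a: "0 < a" "composition \<alpha>" using Cons.prems by (auto simp: composition_def)
  show ?case
  proof (cases "\<alpha> = [] \<and> \<alpha>' \<noteq> [] \<and> (a # \<alpha>) \<odot> \<alpha>' = \<gamma>")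
    case True
    then obtain b \<beta> where "\<alpha>' = b # \<beta>" by (cases \<alpha>') auto
    then show ?thesis using True a Cons.prems(2) by (auto simp: composition_def)
  next
    case False
    then have "\<exists>\<gamma>'. \<gamma> = a # \<gamma>' \<and> (\<alpha> @ \<alpha>' = \<gamma>' \<or> \<alpha> \<odot> \<alpha>' = \<gamma>')"
      using Cons.prems(3) by (cases "\<alpha> = []") auto
    then show ?thesis using Cons.IH a Cons.prems(2) by auto
  qed
qed

lemma coproduct_sum: "\<triangle> (\<Sum>i\<in>S. f i) = (\<Sum>i\<in>S. \<triangle> (f i))"
proof (induction S rule: infinite_finite_induct)
  have "\<triangle> 0 = 0" by (simp add: coproduct_def qcoeff_0)
  then show "\<triangle> (\<Sum>i\<in>S. f i) = (\<Sum>i\<in>S. \<triangle> (f i))" if "infinite S" for S using that by simp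
  show "\<triangle> (\<Sum>i\<in>{}. f i) = (\<Sum>i\<in>{}. \<triangle> (f i))" using \<open>\<triangle> 0 = 0\<close> by simp
qed (simp add: coproduct_add)

lemma tensor_sum:
  "(\<Sum>i\<in>S. f i) \<otimes>\<^sub>Q v = (\<Sum>i\<in>S. f i \<otimes>\<^sub>Q v)" "u \<otimes>\<^sub>Q (\<Sum>i\<in>S. f i) = (\<Sum>i\<in>S. u \<otimes>\<^sub>Q f i)"
proof -
  have zero: "0 \<otimes>\<^sub>Q v = 0" "u \<otimes>\<^sub>Q 0 = 0"
    using tensor_bilinear(1)[of 0 0 v] tensor_bilinear(2)[of u 0 0] by simp_all
  show "(\<Sum>i\<in>S. f i) \<otimes>\<^sub>Q v = (\<Sum>i\<in>S. f i \<otimes>\<^sub>Q v)"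
    by (induction S rule: infinite_finite_induct) (simp_all add: zero tensor_bilinear)
  show "u \<otimes>\<^sub>Q (\<Sum>i\<in>S. f i) = (\<Sum>i\<in>S. u \<otimes>\<^sub>Q f i)"
    by (induction S rule: infinite_finite_induct) (simp_all add: zero tensor_bilinear)
qed

lemma length_refines_le: "refines \<beta> \<alpha> \<Longrightarrow> length \<alpha> \<le> length \<beta>"
proof (induction \<alpha> arbitrary: \<beta>)
  case (Cons a \<alpha>)
  then obtain b \<epsilon> where "b \<noteq> []" "\<beta> = b @ \<epsilon>" "refines \<epsilon> \<alpha>" by (auto simp: refines_Cons_iff)
  then show ?case using Cons.IH[of \<epsilon>] by (cases b) auto
qed simp

lemma composition_refines: "refines \<beta> \<alpha> \<Longrightarrow> composition \<beta> \<Longrightarrow> composition \<alpha>"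
proof (induction \<alpha> arbitrary: \<beta>)
  case (Cons a \<alpha>)
  then obtain b \<epsilon> where b: "b \<noteq> []" "\<beta> = b @ \<epsilon>" "sum_list b = a" "refines \<epsilon> \<alpha>"
    by (auto simp: refines_Cons_iff)
  have "composition b" "composition \<epsilon>" using Cons.prems(2) b(2) by simp_all
  moreover have "0 < a" using b(1,3) \<open>composition b\<close> by (cases b) (auto simp: composition_def)
  ultimately show ?case using Cons.IH[OF b(4)] by (simp add: composition_def)
qed (simp add: composition_def)

text \<open>
  Expand both sides in the tensors \<open>QM \<beta> \<otimes>\<^sub>Q QM \<beta>'\<close>. On the left they come from the refinements
  \<open>\<beta> @ \<beta>'\<close> of \<open>\<gamma>\<close>, on the right from refinements \<open>\<beta>\<close> of \<open>\<alpha>\<close> and \<open>\<beta>'\<close> of \<open>\<alpha>'\<close>; these index sets are in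
  bijection because \<open>(\<alpha>, \<alpha>')\<close> must be \<open>cut (sum_list \<beta>) \<gamma>\<close>. The exponents of \<open>1 - q\<close> agree since a
  near-concatenation of nonempty pieces is one part shorter than the two together, and a
  concatenation is not.
\<close>

lemma coproduct_QMq:
  fixes q :: "'a::comm_ring_1"
  assumes \<gamma>: "composition \<gamma>"
  shows "\<triangle> (QMq q \<gamma>) =
    (\<Sum>(\<alpha>, \<beta>) | composition \<alpha> \<and> composition \<beta> \<and> (\<alpha> @ \<beta> = \<gamma> \<or> \<alpha> \<odot> \<beta> = \<gamma>).
      (1 - q) ^ coproduct_exponent \<gamma> \<alpha> \<beta> *\<^sub>T (QMq q \<alpha> \<otimes>\<^sub>Q QMq q \<beta>))"
proof -
  define R where "R \<alpha> = {\<beta>. composition \<beta> \<and> refines \<beta> \<alpha>}" for \<alpha>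
  define P where "P = {(\<alpha>, \<alpha>'). composition \<alpha> \<and> composition \<alpha>' \<and> (\<alpha> @ \<alpha>' = \<gamma> \<or> \<alpha> \<odot> \<alpha>' = \<gamma>)}"
  define B where "B = {(\<beta>, \<beta>'). composition \<beta> \<and> composition \<beta>' \<and> refines (\<beta> @ \<beta>') \<gamma>}"
  define p where "p = 1 - q"
  define t where "t \<beta> \<beta>' = (QM \<beta> :: 'a qsym) \<otimes>\<^sub>Q QM \<beta>'" for \<beta> \<beta>'
  define F where "F = (\<lambda>((\<alpha>, \<alpha>'), \<beta>, \<beta>'). p ^ coproduct_exponent \<gamma> \<alpha> \<alpha>' *\<^sub>T
    p ^ (length \<beta> - length \<alpha>) *\<^sub>T p ^ (length \<beta>' - length \<alpha>') *\<^sub>T t \<beta> \<beta>')"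
  define G where "G = (\<lambda>(\<beta>, \<beta>'). p ^ (length (\<beta> @ \<beta>') - length \<gamma>) *\<^sub>T t \<beta> \<beta>')"
  define h where "h = (\<lambda>(\<beta>, \<beta>'). (cut (sum_list \<beta>) \<gamma>, \<beta>, \<beta>' :: nat list))"
  have finR: "finite (R \<alpha>)" for \<alpha> unfolding R_def by (rule finite_refinements)
  have finP: "finite P"
  proof (rule finite_subset)
    show "P \<subseteq> (\<lambda>s. cut s \<gamma>) ` {..sum_list \<gamma>}"
    proof
      fix x assume "x \<in> P"
      then obtain \<alpha> \<alpha>' where x: "x = (\<alpha>, \<alpha>')" "composition \<alpha>" "composition \<alpha>'"
        "\<alpha> @ \<alpha>' = \<gamma> \<or> \<alpha> \<odot> \<alpha>' = \<gamma>" by (auto simp: P_def)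
      then have "sum_list \<alpha> \<le> sum_list \<gamma>" using sum_list_near_concat[of \<alpha> \<alpha>'] by auto
      then show "x \<in> (\<lambda>s. cut s \<gamma>) ` {..sum_list \<gamma>}" using cut_unique[OF x(2-4)] x(1) by force
    qed
  qed simp
  have finsplit: "finite {(\<beta>, \<beta>'). \<beta> @ \<beta>' = \<delta>}" for \<delta> :: "nat list"
  proof (rule finite_subset)
    show "{(\<beta>, \<beta>'). \<beta> @ \<beta>' = \<delta>} \<subseteq> (\<lambda>j. (take j \<delta>, drop j \<delta>)) ` {..length \<delta>}"
    proof clarify
      fix \<beta> \<beta>' :: "nat list" assume "\<delta> = \<beta> @ \<beta>'"
      then show "(\<beta>, \<beta>') \<in> (\<lambda>j. (take j (\<beta> @ \<beta>'), drop j (\<beta> @ \<beta>'))) ` {..length (\<beta> @ \<beta>')}"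
        by (intro image_eqI[of _ _ "length \<beta>"]) auto
    qed
  qed simp

  have "\<triangle> (QMq q \<gamma>) = (\<Sum>\<delta>\<in>R \<gamma>. p ^ (length \<delta> - length \<gamma>) *\<^sub>T (\<Sum>(\<beta>, \<beta>') | \<beta> @ \<beta>' = \<delta>. t \<beta> \<beta>'))"
    unfolding QMq_eq_sum_QM[OF \<gamma>] coproduct_sum R_def
    by (intro sum.cong refl) (simp add: coproduct_scale coproduct_QM p_def t_def)
  also have "\<dots> = (\<Sum>\<delta>\<in>R \<gamma>. \<Sum>(\<beta>, \<beta>') | \<beta> @ \<beta>' = \<delta>. p ^ (length (\<beta> @ \<beta>') - length \<gamma>) *\<^sub>T t \<beta> \<beta>')"
    unfolding tscale_sum by (intro sum.cong refl) auto
  also have "\<dots> = (\<Sum>(\<delta>, \<beta>, \<beta>')\<in>(SIGMA \<delta>:R \<gamma>. {(\<beta>, \<beta>'). \<beta> @ \<beta>' = \<delta>}).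
      p ^ (length (\<beta> @ \<beta>') - length \<gamma>) *\<^sub>T t \<beta> \<beta>')"
    by (subst sum.Sigma) (auto simp: finR finsplit intro!: sum.cong)
  also have "\<dots> = sum G B"
    unfolding G_def by (rule sum.reindex_bij_witness[of _ "\<lambda>(\<beta>, \<beta>'). (\<beta> @ \<beta>', \<beta>, \<beta>')" snd])
       (auto simp: R_def B_def)
  also have "\<dots> = sum F (SIGMA x:P. R (fst x) \<times> R (snd x))"
  proof (rule sum.reindex_bij_witness[of _ snd h])
    fix x assume "x \<in> B"
    then obtain \<beta> \<beta>' where x: "x = (\<beta>, \<beta>')" and c: "composition \<beta>" "composition \<beta>'"
      and r: "refines (\<beta> @ \<beta>') \<gamma>" by (auto simp: B_def)
    from r obtain \<alpha> \<alpha>' where \<alpha>: "\<alpha> @ \<alpha>' = \<gamma> \<or> \<alpha> \<odot> \<alpha>' = \<gamma>" "refines \<beta> \<alpha>" "refines \<beta>' \<alpha>'"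
      by (rule refines_appendE)
    have c': "composition \<alpha>" "composition \<alpha>'"
      using c \<alpha>(2,3) composition_refines by blast+
    have cut: "cut (sum_list \<beta>) \<gamma> = (\<alpha>, \<alpha>')"
      using cut_unique[OF c' \<alpha>(1)] refines_sum_list[OF \<alpha>(2)] by simp
    have le: "length \<alpha> \<le> length \<beta>" "length \<alpha>' \<le> length \<beta>'"
      using \<alpha> length_refines_le by blast+
    \<comment> \<open>Cutting inside a part of \<open>\<gamma>\<close> costs one power, which the coproduct exponent supplies.\<close>
    have "coproduct_exponent \<gamma> \<alpha> \<alpha>' + (length \<beta> - length \<alpha>) + (length \<beta>' - length \<alpha>') =
        length (\<beta> @ \<beta>') - length \<gamma>"
    proof (cases "\<alpha> @ \<alpha>' = \<gamma>")
      case True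
      then show ?thesis using le by (auto simp: coproduct_exponent_def)
    next
      case False
      then have "\<alpha> \<noteq> []" "\<alpha>' \<noteq> []" "\<alpha> \<odot> \<alpha>' = \<gamma>" using \<alpha>(1) by auto
      then show ?thesis using le False length_near_concat[of \<alpha> \<alpha>']
        by (auto simp: coproduct_exponent_def)
    qed
    then show "F (h x) = G x"
      unfolding x h_def prod.case cut F_def G_def
      by (simp only: tscale_simps(3)[symmetric] power_add[symmetric] add.assoc)
    show "h x \<in> (SIGMA x:P. R (fst x) \<times> R (snd x))" "snd (h x) = x"
      unfolding x h_def prod.case cut
      using x cut c c' \<alpha> by (simp_all add: P_def R_def)
  next
    fix y assume "y \<in> (SIGMA x:P. R (fst x) \<times> R (snd x))"
    then obtain \<alpha> \<alpha>' \<beta> \<beta>' where y: "y = ((\<alpha>, \<alpha>'), \<beta>, \<beta>')" and c: "composition \<alpha>" "composition \<alpha>'"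
      "\<alpha> @ \<alpha>' = \<gamma> \<or> \<alpha> \<odot> \<alpha>' = \<gamma>" and r: "\<beta> \<in> R \<alpha>" "\<beta>' \<in> R \<alpha>'"
      by (auto simp: P_def)
    then show "snd y \<in> B"
      using refines_append[of \<beta> \<alpha> \<beta>' \<alpha>'] refines_near_concat[of \<beta> \<alpha> \<beta>' \<alpha>']
      by (auto simp: B_def R_def)
    show "h (snd y) = y"
      unfolding h_def using y r cut_unique[OF c] refines_sum_list by (auto simp: R_def)
  qed
  also have "\<dots> = (\<Sum>x\<in>P. \<Sum>y\<in>R (fst x) \<times> R (snd x). F (x, y))"
    by (subst sum.Sigma) (auto simp: finP finR)
  also have "\<dots> = (\<Sum>(\<alpha>, \<alpha>')\<in>P. p ^ coproduct_exponent \<gamma> \<alpha> \<alpha>' *\<^sub>T (QMq q \<alpha> \<otimes>\<^sub>Q QMq q \<alpha>'))"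
  proof (intro sum.cong refl)
    fix x assume "x \<in> P"
    then obtain \<alpha> \<alpha>' where x: "x = (\<alpha>, \<alpha>')" and c: "composition \<alpha>" "composition \<alpha>'" by (auto simp: P_def)
    have "QMq q \<alpha> \<otimes>\<^sub>Q QMq q \<alpha>' = (\<Sum>\<beta>\<in>R \<alpha>. \<Sum>\<beta>'\<in>R \<alpha>'.
        p ^ (length \<beta> - length \<alpha>) *\<^sub>T p ^ (length \<beta>' - length \<alpha>') *\<^sub>T t \<beta> \<beta>')"
      unfolding QMq_eq_sum_QM[OF c(1)] QMq_eq_sum_QM[OF c(2)] R_def[symmetric]
        p_def[symmetric] tensor_sum(1) tensor_bilinear(3)
      unfolding tensor_sum(2) tensor_bilinear(4) tscale_sum t_def ..
    then show "(\<Sum>y\<in>R (fst x) \<times> R (snd x). F (x, y)) =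
      (case x of (\<alpha>, \<alpha>') \<Rightarrow> p ^ coproduct_exponent \<gamma> \<alpha> \<alpha>' *\<^sub>T (QMq q \<alpha> \<otimes>\<^sub>Q QMq q \<alpha>'))"
      by (simp add: x F_def tscale_sum sum.cartesian_product case_prod_unfold)
  qed
  finally show ?thesis unfolding P_def p_def .
qed

section \<open>Subsets that are final in each block\<close>

text \<open>
  The list \<open>\<delta>\<close> cuts the interval that starts after \<open>s\<close> into consecutive blocks; these are the numbers of
  elements of \<open>X\<close> in them. The offset \<open>s\<close> is there for the inductions on \<open>\<delta>\<close>.
\<close>

primrec block_counts :: "nat \<Rightarrow> nat list \<Rightarrow> nat set \<Rightarrow> nat list" where
  "block_counts s [] X = []"
| "block_counts s (d # \<delta>) X = card ({s<..s + d} \<inter> X) # block_counts (s + d) \<delta> X"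

lemma length_block_counts [simp]: "length (block_counts s \<delta> X) = length \<delta>"
  by (induction \<delta> arbitrary: s) auto

lemma block_counts_cong:
  "(\<And>x. s < x \<Longrightarrow> x \<le> s + sum_list \<delta> \<Longrightarrow> x \<in> X \<longleftrightarrow> x \<in> Y) \<Longrightarrow>
    block_counts s \<delta> X = block_counts s \<delta> Y"
proof (induction \<delta> arbitrary: s)
  case (Cons d \<delta>)
  have "{s<..s + d} \<inter> X = {s<..s + d} \<inter> Y"
    using Cons.prems by auto
  moreover have "block_counts (s + d) \<delta> X = block_counts (s + d) \<delta> Y"
    by (rule Cons.IH) (use Cons.prems in auto)
  ultimately show ?case by simp
qed simp

lemma card_interval_split:
  "card ({s<..s + d + x} \<inter> X) = card ({s<..s + d} \<inter> X) + card ({s + d<..s + d + x} \<inter> (X :: nat set))"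
proof -
  have "{s<..s + d + x} \<inter> X = ({s<..s + d} \<inter> X) \<union> ({s + d<..s + d + x} \<inter> X)" by auto
  then show ?thesis by (simp add: card_Un_disjoint disjoint_iff)
qed

lemma psums_block_counts:
  "psums (block_counts s \<delta> X) = (\<lambda>x. card ({s<..s + x} \<inter> X)) ` psums \<delta>"
proof (induction \<delta> arbitrary: s)
  case (Cons d \<delta>)
  have "(+) (card ({s<..s + d} \<inter> X)) ` psums (block_counts (s + d) \<delta> X) =
      (\<lambda>x. card ({s<..s + x} \<inter> X)) ` (+) d ` psums \<delta>"
    unfolding Cons.IH image_image
    by (intro image_cong refl) (simp add: card_interval_split add.assoc[symmetric])
  then show ?case by simp
qed simp

lemma diff_block_counts:
  "map2 (-) \<delta> (block_counts s \<delta> (- X)) = block_counts s \<delta> X"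
proof (induction \<delta> arbitrary: s)
  case (Cons d \<delta>)
  have "{s<..s + d} = ({s<..s + d} \<inter> X) \<union> ({s<..s + d} \<inter> - X)" by auto
  then have "card {s<..s + d} = card ({s<..s + d} \<inter> X) + card ({s<..s + d} \<inter> - X)"
    by (metis card_Un_disjoint disjoint_iff finite_Int finite_greaterThanAtMost Int_iff Compl_iff)
  then show ?case using Cons by simp
qed simp

text \<open>
  Inside each block, \<open>A\<close> is a final segment: an element of \<open>A\<close> whose successor is not in \<open>A\<close> ends its
  block. The last element of the last block meets the condition because \<open>sum_list \<delta>\<close> is a partial sum.
\<close>

definition block_final :: "nat \<Rightarrow> nat list \<Rightarrow> nat set \<Rightarrow> bool" where
  "block_final s \<delta> A \<longleftrightarrow> A \<subseteq> {s<..s + sum_list \<delta>} \<and> (\<forall>i\<in>A. i + 1 \<notin> A \<longrightarrow> i - s \<in> psums \<delta>)"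

text \<open>
  In the first block there is no partial sum strictly between the end points, so \<open>A\<close> is closed under
  successor there, and its complement is an initial segment, determined by its size.
\<close>

lemma block_final_first:
  assumes "block_final s (d # \<delta>) A" "card ({s<..s + d} \<inter> - A) = b"
  shows "A \<inter> {s<..s + d} = {s + b<..s + d}"
proof -
  let ?L = "{s<..s + d} \<inter> - A"
  have next_in: "z + 1 \<in> A" if "z \<in> A" "s < z" "z < s + d" for z
  proof (rule ccontr)
    assume "z + 1 \<notin> A"
    then have "z - s \<in> psums (d # \<delta>)" using assms(1) that by (auto simp: block_final_def)
    then show False using that by auto
  qed
  have up: "x \<in> A" if "y \<in> A" "s < y" "y \<le> x" "x \<le> s + d" for x y
    using that(3,4)
  proof (induction x rule: dec_induct)
    case base
    then show ?case using that by simp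
  next
    case (step x)
    then show ?case using next_in[of x] that by simp
  qed
  have L: "?L = {s<..s + b}"
  proof (cases "?L = {}")
    case True
    then have "b = 0" using assms(2) by simp
    then show ?thesis using True by simp
  next
    case False
    let ?M = "Max ?L"
    have M: "?M \<in> ?L" using False by (intro Max_in) auto
    have "?L = {s<..?M}"
    proof (intro equalityI subsetI)
      fix x assume "x \<in> ?L"
      then show "x \<in> {s<..?M}" by simp
    next
      fix x assume "x \<in> {s<..?M}"
      then show "x \<in> ?L" using up[of x ?M] M by auto
    qed
    then have "b = ?M - s" using assms(2) by (metis card_greaterThanAtMost)
    then show ?thesis using \<open>?L = {s<..?M}\<close> M by auto
  qed
  have "b \<le> d" using assms(2) card_mono[of "{s<..s + d}" ?L] by simp
  then have "{s<..s + d} - {s<..s + b} = {s + b<..s + d}" by auto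
  moreover have "A \<inter> {s<..s + d} = {s<..s + d} - ?L" by auto
  ultimately show ?thesis by (simp only: L)
qed

text \<open>
  A list \<open>\<beta>\<close> below \<open>\<delta>\<close> prescribes how many elements of each block are outside \<open>A\<close>. As these must come
  first in their block, \<open>A\<close> exists and is unique. This is the bijection between the terms of a Cauchy
  product and the sets \<open>A\<close> of the product formula.
\<close>

lemma block_final_ex1:
  assumes "composition \<delta>" "list_all2 (\<le>) \<beta> \<delta>"
  shows "\<exists>!A. block_final s \<delta> A \<and> block_counts s \<delta> (- A) = \<beta>"
  using assms(2,1)
proof (induction \<beta> \<delta> arbitrary: s rule: list_all2_induct)
  case Nil
  then show ?case by (auto simp: block_final_def)
next
  case (Cons b \<beta> d \<delta>)
  have d: "0 < d" "composition \<delta>" using Cons.prems by (auto simp: composition_def)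
  obtain A' where A': "block_final (s + d) \<delta> A'" "block_counts (s + d) \<delta> (- A') = \<beta>"
    and uniq: "\<And>B. block_final (s + d) \<delta> B \<Longrightarrow> block_counts (s + d) \<delta> (- B) = \<beta> \<Longrightarrow> B = A'"
    using Cons.IH[OF d(2), of "s + d"] by blast
  have sub: "A' \<subseteq> {s + d<..s + d + sum_list \<delta>}" using A'(1) by (simp add: block_final_def)
  show ?case
  proof (rule ex1I[of _ "{s + b<..s + d} \<union> A'"], intro conjI)
    let ?A = "{s + b<..s + d} \<union> A'"
    show "block_final s (d # \<delta>) ?A"
      unfolding block_final_def
    proof (intro conjI ballI impI)
      show "?A \<subseteq> {s<..s + sum_list (d # \<delta>)}" using sub \<open>b \<le> d\<close> by auto
      fix i assume i: "i \<in> ?A" "i + 1 \<notin> ?A"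
      show "i - s \<in> psums (d # \<delta>)"
      proof (cases "i \<in> A'")
        case True
        then have "i - (s + d) \<in> psums \<delta>" using A'(1) i by (auto simp: block_final_def)
        moreover have "i - s = d + (i - (s + d))" using True sub by auto
        ultimately show ?thesis by simp
      next
        case False
        then have "i - s = d + 0" using i by auto
        then show ?thesis by (auto intro: image_eqI[of _ _ 0])
      qed
    qed
    have "{s<..s + d} \<inter> - ?A = {s<..s + b}" using sub \<open>b \<le> d\<close> by auto
    moreover have "block_counts (s + d) \<delta> (- ?A) = block_counts (s + d) \<delta> (- A')"
      by (rule block_counts_cong) auto
    ultimately show "block_counts s (d # \<delta>) (- ?A) = b # \<beta>" using A' by simp
  next
    fix A assume A: "block_final s (d # \<delta>) A \<and> block_counts s (d # \<delta>) (- A) = b # \<beta>"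
    let ?B = "A \<inter> {s + d<..}"
    have first: "A \<inter> {s<..s + d} = {s + b<..s + d}"
      using A by (intro block_final_first) auto
    have "block_counts (s + d) \<delta> (- ?B) = block_counts (s + d) \<delta> (- A)"
      by (rule block_counts_cong) auto
    moreover have "block_final (s + d) \<delta> ?B"
      unfolding block_final_def
    proof (intro conjI ballI impI)
      show "?B \<subseteq> {s + d<..s + d + sum_list \<delta>}" using A by (auto simp: block_final_def)
      fix i assume i: "i \<in> ?B" "i + 1 \<notin> ?B"
      then have "i - s \<in> psums (d # \<delta>)" using A by (auto simp: block_final_def)
      then obtain y where "y \<in> psums \<delta>" "i - s = d + y" using i by auto
      then show "i - (s + d) \<in> psums \<delta>" by (metis add_diff_cancel_left' diff_diff_left)
    qed
    ultimately have "?B = A'" using uniq A by simp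
    moreover have "A = (A \<inter> {s<..s + d}) \<union> ?B" using A by (auto simp: block_final_def)
    ultimately show "A = {s + b<..s + d} \<union> A'" using first by simp
  qed
qed

lemma block_final_iff_ends:
  "block_final 0 \<delta> A \<longleftrightarrow> A \<subseteq> {1..sum_list \<delta>} \<and> ends (sum_list \<delta>) A \<subseteq> psums \<delta>"
proof -
  have "(i + 1 \<notin> A \<longrightarrow> i \<in> psums \<delta>) \<longleftrightarrow> (i \<in> ends (sum_list \<delta>) A \<longrightarrow> i \<in> psums \<delta>)"
    if "A \<subseteq> {1..sum_list \<delta>}" "i \<in> A" for i
  proof (cases "i = sum_list \<delta>")
    case False
    then have "i \<in> {1..sum_list \<delta> - 1}" using that by fastforce
    then show ?thesis using that(2) by (simp add: ends_def)
  qed simp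
  moreover have "ends (sum_list \<delta>) A \<subseteq> A" by (auto simp: ends_def)
  moreover have "{0<..0 + sum_list \<delta>} = {1..sum_list \<delta>}" by auto
  ultimately show ?thesis unfolding block_final_def diff_zero by (metis subset_iff)
qed

lemma sum_list_block_counts:
  "sum_list (block_counts s \<delta> X) = card ({s<..s + sum_list \<delta>} \<inter> X)"
  by (induction \<delta> arbitrary: s) (simp_all add: card_interval_split add.assoc[symmetric])

lemma block_counts_le: "list_all2 (\<le>) (block_counts s \<delta> X) \<delta>"
proof (induction \<delta> arbitrary: s)
  case (Cons d \<delta>)
  have "card ({s<..s + d} \<inter> X) \<le> card {s<..s + d}" by (rule card_mono) auto
  then show ?case using Cons by simp
qed simp

lemma sum_list_diff:
  "list_all2 (\<le>) \<beta> \<delta> \<Longrightarrow> sum_list \<beta> + sum_list (map2 (-) \<delta> \<beta>) = sum_list (\<delta> :: nat list)"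
  by (induction rule: list_all2_induct) auto

section \<open>Ranks\<close>

text \<open>
  On a finite set \<open>B\<close> of positive integers, this is the inverse of \<open>kth B\<close>.
\<close>

definition rank :: "nat set \<Rightarrow> nat \<Rightarrow> nat" where
  "rank B x = card ({1..x} \<inter> B)"

lemma kth_strict_mono:
  assumes "finite B" "1 \<le> i" "i < j" "j \<le> card B"
  shows "kth B i < kth B j"
  unfolding kth_def using assms
  by (intro sorted_wrt_nth_less[OF strict_sorted_list_of_set]) auto

lemma kth_image: "finite B \<Longrightarrow> kth B ` {1..card B} = B"
proof -
  assume fin: "finite B"
  have "kth B ` {1..card B} = (!) (sorted_list_of_set B) ` {..<card B}"
  proof -
    have "(\<lambda>i. i - 1) ` {1..card B} = {..<card B}" by (force intro: image_eqI[of _ _ "Suc _"])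
    then show ?thesis unfolding kth_def by (metis image_image)
  qed
  also have "\<dots> = set (sorted_list_of_set B)" by (auto simp: set_conv_nth)
  finally show ?thesis using fin by simp
qed

lemma kth_inj_on: "finite B \<Longrightarrow> inj_on (kth B) {1..card B}"
  by (rule linorder_inj_onI') (metis atLeastAtMost_iff kth_strict_mono less_irrefl)

lemma rank_kth:
  assumes "finite B" "0 \<notin> B" "i \<in> {1..card B}"
  shows "rank B (kth B i) = i"
proof -
  have mono: "kth B j \<le> kth B i \<longleftrightarrow> j \<le> i" if "j \<in> {1..card B}" for j
    using kth_strict_mono[OF assms(1), of j i] kth_strict_mono[OF assms(1), of i j] assms(3) that
    by (metis atLeastAtMost_iff leD le_less linorder_le_less_linear)
  have "{1..kth B i} \<inter> B = {x \<in> kth B ` {1..card B}. x \<le> kth B i}"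
    unfolding kth_image[OF assms(1)] using assms(2) by (auto simp: Suc_le_eq intro: Nat.gr0I)
  also have "\<dots> = kth B ` {1..i}"
    using mono assms(3) by (auto simp: image_iff)
  finally have "rank B (kth B i) = card (kth B ` {1..i})" by (simp add: rank_def)
  also have "\<dots> = card {1..i}"
    using assms(3) by (intro card_image inj_on_subset[OF kth_inj_on[OF assms(1)]]) auto
  finally show ?thesis by simp
qed

lemma kth_rank:
  assumes "finite B" "0 \<notin> B" "x \<in> B"
  shows "kth B (rank B x) = x"
  using assms kth_image[OF assms(1)] rank_kth[OF assms(1,2)] by (metis imageE)

lemma rank_inj_on: "finite B \<Longrightarrow> 0 \<notin> B \<Longrightarrow> inj_on (rank B) B"
  by (metis inj_onI kth_rank)

lemma rank_eq_if_gap: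
  assumes "x \<le> y" "\<And>z. x < z \<Longrightarrow> z \<le> y \<Longrightarrow> z \<notin> B"
  shows "rank B x = rank B y"
proof -
  have "z \<le> x" if "z \<in> B" "z \<le> y" for z using assms(2)[of z] that by (meson not_le)
  then have "{1..x} \<inter> B = {1..y} \<inter> B" using assms(1) by auto
  then show ?thesis by (simp add: rank_def)
qed

text \<open>
  The partial sums of the block counts of \<open>B\<close> are the values of \<open>rank B\<close> at the block boundaries \<open>D\<close>.
  The rank at a boundary is the rank of the last element \<open>y\<close> of \<open>B\<close> up to it, and \<open>y\<close> is itself a boundary
  or is followed by an element outside \<open>B\<close>. Conversely, if \<open>y + 1 \<notin> B\<close> but \<open>y\<close> is not a boundary, then
  \<open>B\<close> has no elements between \<open>y\<close> and the next boundary: returning to \<open>B\<close> would be an end of the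
  complement inside a block.
\<close>

lemma rank_image_cuts:
  assumes B: "B \<subseteq> {1..N}" and D: "D \<subseteq> {0..N}" "0 \<in> D" "N \<in> D"
    and ends: "ends N B \<subseteq> D \<or> ends N ({1..N} - B) \<subseteq> D"
  shows "rank B ` D = insert 0 (rank B ` (B \<inter> (D \<union> ends N B)))"
proof (intro equalityI subsetI)
  fix u assume "u \<in> rank B ` D"
  then obtain d where d: "d \<in> D" "u = rank B d" by blast
  let ?L = "{1..d} \<inter> B"
  show "u \<in> insert 0 (rank B ` (B \<inter> (D \<union> ends N B)))"
  proof (cases "?L = {}")
    case True
    then show ?thesis using d by (simp add: rank_def)
  next
    case False
    define y where "y = Max ?L"
    have y: "y \<in> ?L" unfolding y_def using False by (intro Max_in) auto
    have gap: "z \<notin> B" if "y < z" "z \<le> d" for z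
    proof
      assume "z \<in> B"
      then have "z \<le> y" unfolding y_def using that(2) B by (intro Max_ge) auto
      then show False using that by simp
    qed
    have "y \<in> D \<union> ends N B"
    proof (cases "y = d")
      case False
      then have "y < d" "d \<le> N" using y d D by auto
      then show ?thesis using gap[of "y + 1"] y by (auto simp: ends_def)
    qed (use d in simp)
    moreover have "rank B y = u" using d rank_eq_if_gap[of y d B] gap y by auto
    ultimately show ?thesis using y by blast
  qed
next
  fix u assume "u \<in> insert 0 (rank B ` (B \<inter> (D \<union> ends N B)))"
  then consider "u = 0" | y where "y \<in> D" "u = rank B y" | y where "y \<in> ends N B - D" "u = rank B y"
    by blast
  then show "u \<in> rank B ` D"
  proof cases
    case 1
    have "rank B 0 = 0" by (simp add: rank_def)
    then show ?thesis using 1 D(2) by (metis imageI)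
  next
    case 2
    then show ?thesis by blast
  next
    case 3
    then have e: "ends N ({1..N} - B) \<subseteq> D" using ends by blast
    have y: "y \<in> B" "y + 1 \<notin> B" "y < N" using 3 by (auto simp: ends_def)
    let ?K = "{d \<in> D. y < d}"
    define x where "x = Min ?K"
    have fin: "finite ?K" using D finite_subset by fastforce
    have x: "x \<in> ?K" unfolding x_def by (rule Min_in[OF fin]) (use y D in auto)
    have gap: "z \<notin> B" if "y + 1 \<le> z" "z \<le> x" for z
      using that
    proof (induction z rule: dec_induct)
      case base
      then show ?case using y by simp
    next
      case (step z)
      have "z \<notin> ?K" using step.prems Min_le[OF fin, of z] unfolding x_def by auto
      then have "z \<notin> D" using step.hyps by auto
      moreover have "Suc z \<le> N" using step.prems x D by auto
      ultimately show ?case using step e B by (auto simp: ends_def subset_iff)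
    qed
    have "rank B y = rank B x" using gap x by (intro rank_eq_if_gap) auto
    then show ?thesis using 3 x by auto
  qed
qed

lemma card_rank_image:
  assumes "finite B" "0 \<notin> B"
  shows "card (insert 0 (rank B ` (B \<inter> E))) = Suc (card (B \<inter> E))"
proof -
  have "rank B x \<noteq> 0" if "x \<in> B" for x
    using that assms kth_image[OF assms(1)] rank_kth[OF assms] by (metis atLeastAtMost_iff imageE not_one_le_zero)
  then have "0 \<notin> rank B ` (B \<inter> E)" by force
  moreover have "card (rank B ` (B \<inter> E)) = card (B \<inter> E)"
    by (rule card_image) (rule inj_on_subset[OF rank_inj_on[OF assms]], simp)
  ultimately show ?thesis using assms(1) by simp
qed

lemma subset_rank_image_iff:
  assumes "finite B" "0 \<notin> B" "I \<subseteq> {1..card B}"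
  shows "I \<subseteq> insert 0 (rank B ` (B \<inter> E)) \<longleftrightarrow> kth B ` I \<subseteq> E"
proof -
  have "i \<in> insert 0 (rank B ` (B \<inter> E)) \<longleftrightarrow> kth B i \<in> E" if "i \<in> I" for i
  proof
    have i: "i \<in> {1..card B}" using that assms(3) by blast
    {
      assume "i \<in> insert 0 (rank B ` (B \<inter> E))"
      then obtain x where "x \<in> B \<inter> E" "i = rank B x" using i by auto
      then show "kth B i \<in> E" using kth_rank[OF assms(1,2)] by simp
    next
      assume "kth B i \<in> E"
      moreover have "kth B i \<in> B" using kth_image[OF assms(1)] i by blast
      moreover have "i = rank B (kth B i)" using rank_kth[OF assms(1,2) i] by simp
      ultimately show "i \<in> insert 0 (rank B ` (B \<inter> E))" by blast
    }
  qed
  then show ?thesis by blast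
qed

lemma kth_image_bounds:
  assumes "B \<subseteq> {1..N}" "I \<subseteq> {1..card B - 1}"
  shows "kth B ` I \<subseteq> B \<inter> {1..N - 1}" "card (kth B ` I) = card I" "kth B (card B) \<notin> kth B ` I"
proof -
  have fin: "finite B" using assms(1) finite_subset by blast
  have sub: "I \<subseteq> {1..card B}" using assms(2) by fastforce
  have lt: "kth B i < kth B (card B)" if "i \<in> I" for i
    using subsetD[OF assms(2) that] by (intro kth_strict_mono[OF fin]) auto
  have "kth B i \<in> B \<inter> {1..N - 1}" if "i \<in> I" for i
  proof -
    have "card B \<in> {1..card B}" using subsetD[OF assms(2) that] by auto
    then have "kth B i \<in> B" "kth B (card B) \<in> B" using kth_image[OF fin] sub that by blast+
    then show ?thesis using lt[OF that] assms(1) by fastforce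
  qed
  then show "kth B ` I \<subseteq> B \<inter> {1..N - 1}" by blast
  show "card (kth B ` I) = card I"
    by (rule card_image) (rule inj_on_subset[OF kth_inj_on[OF fin] sub])
  show "kth B (card B) \<notin> kth B ` I"
  proof
    assume "kth B (card B) \<in> kth B ` I"
    then obtain i where "i \<in> I" "kth B (card B) = kth B i" by (rule imageE)
    then show False using lt[of i] by simp
  qed
qed

section \<open>The exponents of the product formula\<close>

lemma last_in_ends:
  assumes "B \<subseteq> {1..N}" "B \<noteq> {}" "N \<notin> B"
  shows "kth B (card B) \<in> ends N B"
proof -
  have fin: "finite B" using assms(1) finite_subset by blast
  let ?y = "kth B (card B)"
  have c: "card B \<in> {1..card B}" using assms(2) fin by (simp add: Suc_le_eq card_gt_0_iff)
  then have y: "?y \<in> B" using kth_image[OF fin] by blast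
  moreover have "?y + 1 \<notin> B"
  proof
    assume "?y + 1 \<in> B"
    then obtain j where j: "j \<in> {1..card B}" "kth B j = ?y + 1"
      using kth_image[OF fin] by (metis imageE)
    then have "j < card B" by (cases "j = card B") auto
    then show False using kth_strict_mono[OF fin, of j "card B"] j by simp
  qed
  moreover have "1 \<le> ?y" "?y < N"
    using subsetD[OF assms(1) y] y assms(3) by (auto simp: le_less)
  ultimately show ?thesis by (simp add: ends_def)
qed

text \<open>
  Whichever of \<open>A\<close> and its complement does not contain \<open>N\<close> has its largest element in
  \<open>all_ends N A\<close>, and that element is not in the hash because \<open>I\<close> omits \<open>m\<close> and \<open>J\<close> omits \<open>n\<close>. So the
  subtraction of 1 in \<open>product_exponent\<close> is not truncated.
\<close>

lemma all_ends_not_subset_hash: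
  assumes "A \<subseteq> {1..N}" "card A = n" "N = m + n" "0 < m" "0 < n"
    and "I \<subseteq> {1..m - 1}" "J \<subseteq> {1..n - 1}"
  shows "\<not> all_ends N A \<subseteq> hash N A I J"
proof -
  let ?C = "{1..N} - A"
  have C: "card ?C = m" using assms(1-3) finite_subset[OF assms(1)] by (simp add: card_Diff_subset)
  note KC = kth_image_bounds[of ?C N I] and KA = kth_image_bounds[OF assms(1), of J]
  have IC: "kth ?C ` I \<subseteq> ?C" using KC(1) C assms by auto
  have JA: "kth A ` J \<subseteq> A" using KA(1) assms by auto
  show ?thesis
  proof (cases "N \<in> A")
    case True
    have "?C \<noteq> {}" using C assms(4) by (metis card.empty less_irrefl)
    then have y: "kth ?C (card ?C) \<in> ends N ?C" using True by (intro last_in_ends) auto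
    then have "kth ?C (card ?C) \<notin> A" by (auto simp: ends_def)
    moreover have "kth ?C (card ?C) \<notin> kth ?C ` I" using KC(3) C assms by auto
    ultimately show ?thesis using y JA unfolding all_ends_def hash_def by blast
  next
    case False
    then have y: "kth A (card A) \<in> ends N A" using assms by (intro last_in_ends) auto
    then have "kth A (card A) \<in> A" by (auto simp: ends_def)
    moreover have "kth A (card A) \<notin> kth A ` J" using KA(3) assms by auto
    ultimately show ?thesis using y IC unfolding all_ends_def hash_def by blast
  qed
qed

lemma hash_properties:
  assumes "A \<subseteq> {1..N}" "card A = n" "N = m + n" "I \<subseteq> {1..m - 1}" "J \<subseteq> {1..n - 1}"
  shows hash_subset: "hash N A I J \<subseteq> {1..N - 1}"
    and card_hash: "card (hash N A I J) = card I + card J"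
proof -
  let ?C = "{1..N} - A"
  have C: "card ?C = m" using assms(1-3) finite_subset[OF assms(1)] by (simp add: card_Diff_subset)
  have KC: "kth ?C ` I \<subseteq> ?C \<inter> {1..N - 1}" "card (kth ?C ` I) = card I"
    using kth_image_bounds[of ?C N I] C assms by auto
  have KA: "kth A ` J \<subseteq> A \<inter> {1..N - 1}" "card (kth A ` J) = card J"
    using kth_image_bounds[OF assms(1), of J] assms by auto
  show "hash N A I J \<subseteq> {1..N - 1}" using KC KA by (auto simp: hash_def)
  have "finite I" "finite J" using assms finite_subset by blast+
  moreover have "kth ?C ` I \<inter> kth A ` J = {}" using KC(1) KA(1) by blast
  ultimately show "card (hash N A I J) = card I + card J"
    using KC(2) KA(2) by (simp add: hash_def card_Un_disjoint)
qed

text \<open>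
  Why the inner sum over \<open>S\<close> has these weights: each point of \<open>X \<inter> D\<close> is either put into \<open>S\<close>, with weight \<open>q\<close>, or
  left to the refinement, with weight \<open>1 - q\<close>, and the two weights add up to 1. In the application
  \<open>D'\<close> is \<open>D\<close> without its end points.
\<close>

lemma sum_over_extra_cuts:
  fixes q :: "'a::comm_ring_1"
  assumes "finite X" "finite D" "sh \<inter> X = {}" "X \<inter> D \<subseteq> D'" "D' \<subseteq> D"
  shows "(\<Sum>S | S \<subseteq> X. q ^ card S * (if sh \<union> S \<subseteq> D then (1 - q) ^ card (D' - (sh \<union> S)) else 0)) =
    (if sh \<subseteq> D then (1 - q) ^ card (D' - sh - X) else 0)"
proof (cases "sh \<subseteq> D")
  case True
  let ?w = "\<lambda>S. q ^ card S * (if sh \<union> S \<subseteq> D then (1 - q) ^ card (D' - (sh \<union> S)) else 0)"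
  have "sum ?w {S. S \<subseteq> X} =
      (\<Sum>S | S \<subseteq> X \<inter> D. (1 - q) ^ card (D' - sh - X) * (q ^ card S * (1 - q) ^ card (X \<inter> D - S)))"
  proof (rule sum.mono_neutral_cong_right)
    fix S assume "S \<in> {S. S \<subseteq> X \<inter> D}"
    then have S: "S \<subseteq> X" "S \<subseteq> D" by auto
    have "D' - (sh \<union> S) = (D' - sh - X) \<union> (X \<inter> D - S)" using S assms(3,4,5) by blast
    moreover have "card ((D' - sh - X) \<union> (X \<inter> D - S)) = card (D' - sh - X) + card (X \<inter> D - S)"
      using assms by (intro card_Un_disjoint) (auto intro: finite_subset)
    ultimately show "?w S = (1 - q) ^ card (D' - sh - X) * (q ^ card S * (1 - q) ^ card (X \<inter> D - S))"
      using S True by (simp add: power_add algebra_simps)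
  qed (use assms in auto)
  also have "\<dots> = (1 - q) ^ card (D' - sh - X)"
    unfolding sum_distrib_left[symmetric]
    using sum_power_card_subsets[of "X \<inter> D" q "1 - q"] assms by simp
  finally show ?thesis using True by simp
qed simp

text \<open>
  Put \<open>e = all_ends N A\<close> and \<open>H = hash N A I J\<close>. The \<open>H - e\<close> are lost from the boundaries outside \<open>e\<close>, the
  \<open>e - H\<close> are gained from \<open>product_exponent\<close>, and \<open>card (e - H) - card (H - e) = card e - card H\<close>. The 3 is made
  of the two end points and the 1 in \<open>product_exponent\<close>.
\<close>

lemma exponent_identity:
  assumes A: "A \<subseteq> {1..N}" "card A = n" "N = m + n" and pos: "0 < m" "0 < n"
    and I: "I \<subseteq> {1..m - 1}" "J \<subseteq> {1..n - 1}"
    and D: "D \<subseteq> {0..N}" "0 \<in> D" "N \<in> D" and eD: "ends N A \<subseteq> D"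
    and H: "hash N A I J \<subseteq> D \<union> all_ends N A"
  shows "product_exponent N A I J
      + card (D - {0, N} - shuffle N A I J - ends N ({1..N} - A)) + card I + card J + 3
    = card (D \<union> all_ends N A)"
proof -
  let ?e = "all_ends N A" and ?H = "hash N A I J"
  define D' where "D' = D - {0, N} - ?e"
  have e: "?e \<subseteq> {1..N - 1}" by (auto simp: all_ends_def ends_def)
  have Hs: "?H \<subseteq> {1..N - 1}" and cH: "card ?H = card I + card J"
    using hash_subset[OF A I] card_hash[OF A I] by auto
  have fin: "finite D" "finite ?e" "finite ?H" using D(1) e Hs finite_subset by blast+
  have "D - {0, N} - shuffle N A I J - ends N ({1..N} - A) = D' - (?H - ?e)"
    by (auto simp: D'_def shuffle_def all_ends_def)
  moreover have sub: "?H - ?e \<subseteq> D'" using H Hs pos A(3) by (auto simp: D'_def)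
  have finD': "finite D'" using fin by (simp add: D'_def)
  ultimately have c1: "card (D - {0, N} - shuffle N A I J - ends N ({1..N} - A)) + card (?H - ?e) = card D'"
    using card_mono[OF finD' sub] card_Diff_subset[OF _ sub] fin by simp
  have "D \<union> ?e = {0, N} \<union> (D' \<union> ?e)" using D by (auto simp: D'_def)
  moreover have "card ({0, N} \<union> (D' \<union> ?e)) = card {0, N} + card (D' \<union> ?e)"
    using fin finD' e pos A(3) by (intro card_Un_disjoint) (auto simp: D'_def)
  moreover have "card (D' \<union> ?e) = card D' + card ?e"
    using fin finD' by (intro card_Un_disjoint) (auto simp: D'_def)
  ultimately have c2: "card (D \<union> ?e) = 2 + card D' + card ?e" using pos A(3) by simp
  have c3: "card ?H = card (?H - ?e) + card (?H \<inter> ?e)" "card ?e = card (?e - ?H) + card (?H \<inter> ?e)"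
    using fin card_Diff_subset_Int[of ?H ?e] card_Diff_subset_Int[of ?e ?H]
      card_mono[of ?H "?H \<inter> ?e"] card_mono[of ?e "?H \<inter> ?e"] by (simp_all add: Int_commute)
  have "?e - ?H \<noteq> {}" using all_ends_not_subset_hash[OF A pos I] by blast
  then have "0 < card (?e - ?H)" using fin by (simp add: card_gt_0_iff)
  then show ?thesis using c1 c2 c3 cH by (simp add: product_exponent_def)
qed

section \<open>The product\<close>

lemma shuffle_subset:
  "hash N A I J \<subseteq> {1..N - 1} \<Longrightarrow> shuffle N A I J \<subseteq> {1..N - 1}"
  by (auto simp: shuffle_def ends_def)

text \<open>
  The boundaries \<open>E\<close> of the blocks together with the ends of the runs of \<open>A\<close> and of its complement
  are, apart from 0, distributed between \<open>A\<close> and the complement \<open>C\<close>. Ranking turns the two parts into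
  the nonzero partial sums of the two factors of the monomial. Hence the two exponents add up to a
  function of \<open>card E\<close>, and the conditions \<open>I \<subseteq> U\<close> and \<open>J \<subseteq> V\<close> together become \<open>hash N A I J \<subseteq> E\<close>.
\<close>

lemma qcoeff_mult_block_counts:
  fixes q :: "'a::comm_ring_1"
  assumes A: "A \<subseteq> {1..N}" "card A = n" "N = m + n" and pos: "0 < m" "0 < n"
    and I: "I \<subseteq> {1..m - 1}" "J \<subseteq> {1..n - 1}"
    and \<delta>: "sum_list \<delta> = N" and eD: "ends N A \<subseteq> psums \<delta>"
  shows "qcoeff (QMq q (comp_of m I)) (block_counts 0 \<delta> (- A)) *
      qcoeff (QMq q (comp_of n J)) (block_counts 0 \<delta> A) =
    (if hash N A I J \<subseteq> psums \<delta> \<union> all_ends N A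
     then (1 - q) ^ (card (psums \<delta> \<union> all_ends N A) - (card I + card J + 3)) else 0)"
proof -
  define C where "C = {1..N} - A"
  define D where "D = psums \<delta>"
  define E where "E = D \<union> all_ends N A"
  define U where "U = psums (block_counts 0 \<delta> (- A))"
  define V where "V = psums (block_counts 0 \<delta> A)"
  have finA: "finite A" "finite C" using A(1) finite_subset by (auto simp: C_def)
  have zero: "0 \<notin> A" "0 \<notin> C" using A(1) by (auto simp: C_def)
  have C: "C \<subseteq> {1..N}" "card C = m" "{1..N} - C = A"
    using A finA by (auto simp: C_def card_Diff_subset)
  have D: "D \<subseteq> {0..N}" "0 \<in> D" "N \<in> D" "finite D"
    using psums_le[of _ \<delta>] \<delta> by (auto simp: D_def)
  have E: "finite E" "0 \<in> E" "E \<subseteq> {0..N}"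
    using D by (auto simp: E_def all_ends_def ends_def)
  have sums: "sum_list (block_counts 0 \<delta> (- A)) = m" "sum_list (block_counts 0 \<delta> A) = n"
  proof -
    have "{0<..0 + sum_list \<delta>} \<inter> - A = C" "{0<..0 + sum_list \<delta>} \<inter> A = A"
      using A(1) \<delta> by (auto simp: C_def)
    then show "sum_list (block_counts 0 \<delta> (- A)) = m" "sum_list (block_counts 0 \<delta> A) = n"
      using C(2) A(2) unfolding sum_list_block_counts by simp_all
  qed
  have "U = rank C ` D" unfolding U_def D_def psums_block_counts
  proof (rule image_cong[OF refl])
    fix x assume "x \<in> psums \<delta>"
    then have "{0<..0 + x} \<inter> - A = {1..x} \<inter> C" using psums_le[of x \<delta>] \<delta> by (auto simp: C_def)
    then show "card ({0<..0 + x} \<inter> - A) = rank C x" by (simp add: rank_def)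
  qed
  also have "\<dots> = insert 0 (rank C ` (C \<inter> (D \<union> ends N C)))"
    by (rule rank_image_cuts[OF C(1) D(1-3)]) (simp add: C(3) D_def eD del: One_nat_def)
  also have "C \<inter> (D \<union> ends N C) = C \<inter> E" by (auto simp: E_def all_ends_def C_def ends_def)
  finally have U: "U = insert 0 (rank C ` (C \<inter> E))" .
  have "V = rank A ` D" unfolding V_def D_def psums_block_counts
  proof (rule image_cong[OF refl])
    fix x
    have "{0<..0 + x} \<inter> A = {1..x} \<inter> A" by auto
    then show "card ({0<..0 + x} \<inter> A) = rank A x" by (simp add: rank_def)
  qed
  also have "\<dots> = insert 0 (rank A ` (A \<inter> (D \<union> ends N A)))"
    by (rule rank_image_cuts[OF A(1) D(1-3)]) (simp add: D_def eD)
  also have "A \<inter> (D \<union> ends N A) = A \<inter> E" by (auto simp: E_def all_ends_def ends_def)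
  finally have V: "V = insert 0 (rank A ` (A \<inter> E))" .
  have cards: "card U + card V = Suc (card E)"
  proof -
    have "E = insert 0 ((C \<inter> E) \<union> (A \<inter> E))" using E by (auto simp: C_def Suc_le_eq)
    moreover have "card (insert 0 ((C \<inter> E) \<union> (A \<inter> E))) = Suc (card (C \<inter> E) + card (A \<inter> E))"
      using finA zero by (subst card_insert_disjoint) (auto simp: C_def card_Un_disjoint disjoint_iff)
    ultimately show ?thesis
      using card_rank_image[OF finA(2) zero(2), of E] card_rank_image[OF finA(1) zero(1), of E]
      by (simp add: U V)
  qed
  have iff: "I \<subseteq> U \<longleftrightarrow> kth C ` I \<subseteq> E" "J \<subseteq> V \<longleftrightarrow> kth A ` J \<subseteq> E"
  proof -
    have "I \<subseteq> {1..card C}" "J \<subseteq> {1..card A}" using I C(2) A(2) by fastforce+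
    then show "I \<subseteq> U \<longleftrightarrow> kth C ` I \<subseteq> E" "J \<subseteq> V \<longleftrightarrow> kth A ` J \<subseteq> E"
      unfolding U V using finA zero by (intro subset_rank_image_iff; simp)+
  qed
  have ends01: "0 \<in> U" "m \<in> U" "0 \<in> V" "n \<in> V"
    using sums sum_list_in_psums unfolding U_def V_def by (metis zero_in_psums)+
  have fin: "finite U" "finite V" by (simp_all add: U_def V_def)
  have card_base: "card (insert 0 (insert k K)) = card K + 2" if "K \<subseteq> {1..k - 1}" "0 < k" for k and K :: "nat set"
  proof -
    have "finite K" "0 \<notin> K" "k \<notin> K" using that finite_subset[OF that(1)] by auto
    then show ?thesis using that by simp
  qed
  have cU: "card (U - insert 0 (insert m I)) + card I + 2 = card U" if "I \<subseteq> U"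
  proof -
    have sub: "insert 0 (insert m I) \<subseteq> U" using that ends01 by simp
    have "finite (insert 0 (insert m I))" by (rule finite_subset[OF sub fin(1)])
    then show ?thesis
      using card_Diff_subset[OF _ sub] card_mono[OF fin(1) sub] card_base[OF I(1) pos(1)] by simp
  qed
  have cV: "card (V - insert 0 (insert n J)) + card J + 2 = card V" if "J \<subseteq> V"
  proof -
    have sub: "insert 0 (insert n J) \<subseteq> V" using that ends01 by simp
    have "finite (insert 0 (insert n J))" by (rule finite_subset[OF sub fin(2)])
    then show ?thesis
      using card_Diff_subset[OF _ sub] card_mono[OF fin(2) sub] card_base[OF I(2) pos(2)] by simp
  qed
  have u: "qcoeff (QMq q (comp_of m I)) (block_counts 0 \<delta> (- A)) =
      (if I \<subseteq> U then (1 - q) ^ card (U - insert 0 (insert m I)) else 0)"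
    using ends01 sums qcoeff_QMq[OF composition_comp_of[OF I(1)], of q "block_counts 0 \<delta> (- A)"]
    by (simp add: sum_list_comp_of[OF I(1)] psums_comp_of[OF I(1)] U_def[symmetric])
  have v: "qcoeff (QMq q (comp_of n J)) (block_counts 0 \<delta> A) =
      (if J \<subseteq> V then (1 - q) ^ card (V - insert 0 (insert n J)) else 0)"
    using ends01 sums qcoeff_QMq[OF composition_comp_of[OF I(2)], of q "block_counts 0 \<delta> A"]
    by (simp add: sum_list_comp_of[OF I(2)] psums_comp_of[OF I(2)] V_def[symmetric])
  have hash: "hash N A I J \<subseteq> E \<longleftrightarrow> I \<subseteq> U \<and> J \<subseteq> V"
    unfolding iff hash_def C_def by simp
  have "card (U - insert 0 (insert m I)) + card (V - insert 0 (insert n J)) = card E - (card I + card J + 3)"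
    if "I \<subseteq> U" "J \<subseteq> V"
    using cU[OF that(1)] cV[OF that(2)] cards by simp
  then show ?thesis
    unfolding u v D_def[symmetric] E_def[symmetric] hash by (simp add: power_add[symmetric])
qed

text \<open>
  The coefficient of the summand of \<open>A\<close> on the right-hand side of the product formula. It vanishes
  unless \<open>A\<close> is a final segment of each block of \<open>\<delta>\<close>, and then agrees with
  \<open>qcoeff_mult_block_counts\<close>.
\<close>

lemma qcoeff_shuffle_term:
  fixes q :: "'a::comm_ring_1"
  assumes A: "A \<subseteq> {1..N}" "card A = n" "N = m + n" and pos: "0 < m" "0 < n"
    and I: "I \<subseteq> {1..m - 1}" "J \<subseteq> {1..n - 1}"
    and \<delta>: "sum_list \<delta> = N"
  shows "qcoeff ((1 - q) ^ product_exponent N A I J *\<^sub>Q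
      (\<Sum>S | S \<subseteq> ends N ({1..N} - A). q ^ card S *\<^sub>Q QMq q (comp_of N (shuffle N A I J \<union> S)))) \<delta> =
    (if ends N A \<subseteq> psums \<delta> \<and> hash N A I J \<subseteq> psums \<delta> \<union> all_ends N A
     then (1 - q) ^ (card (psums \<delta> \<union> all_ends N A) - (card I + card J + 3)) else 0)"
proof -
  define D where "D = psums \<delta>"
  define X where "X = ends N ({1..N} - A)"
  define sh where "sh = shuffle N A I J"
  have D: "D \<subseteq> {0..N}" "0 \<in> D" "N \<in> D" "finite D"
    using psums_le[of _ \<delta>] \<delta> by (auto simp: D_def)
  have X: "X \<subseteq> {1..N - 1}" by (auto simp: X_def ends_def)
  have sh: "sh \<subseteq> {1..N - 1}" unfolding sh_def by (intro shuffle_subset hash_subset[OF A I])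
  have disj: "sh \<inter> X = {}" by (auto simp: sh_def X_def shuffle_def all_ends_def ends_def)
  have coeff: "qcoeff (QMq q (comp_of N (sh \<union> S))) \<delta> =
      (if sh \<union> S \<subseteq> D then (1 - q) ^ card (D - {0, N} - (sh \<union> S)) else 0)" if "S \<subseteq> X" for S
  proof -
    have K: "sh \<union> S \<subseteq> {1..N - 1}" using that sh X by blast
    have "D - insert 0 (insert N (sh \<union> S)) = D - {0, N} - (sh \<union> S)" by blast
    then show ?thesis
      using D(2,3) qcoeff_QMq[OF composition_comp_of[OF K], of q \<delta>]
      by (simp add: sum_list_comp_of[OF K] psums_comp_of[OF K] \<delta> D_def[symmetric])
  qed
  have "qcoeff ((1 - q) ^ product_exponent N A I J *\<^sub>Q
      (\<Sum>S | S \<subseteq> X. q ^ card S *\<^sub>Q QMq q (comp_of N (sh \<union> S)))) \<delta> =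
    (1 - q) ^ product_exponent N A I J * (\<Sum>S | S \<subseteq> X. q ^ card S *
      (if sh \<union> S \<subseteq> D then (1 - q) ^ card (D - {0, N} - (sh \<union> S)) else 0))"
    unfolding qcoeff_scale qcoeff_sum by (intro arg_cong2[where f = "(*)"] sum.cong refl) (simp add: coeff)
  also have "\<dots> = (1 - q) ^ product_exponent N A I J *
      (if sh \<subseteq> D then (1 - q) ^ card (D - {0, N} - sh - X) else 0)"
    by (subst sum_over_extra_cuts) (use D X disj pos A(3) finite_subset[OF X] in auto)
  also have "\<dots> = (if ends N A \<subseteq> D \<and> hash N A I J \<subseteq> D \<union> all_ends N A
     then (1 - q) ^ (card (D \<union> all_ends N A) - (card I + card J + 3)) else 0)"
  proof -
    have "sh \<subseteq> D \<longleftrightarrow> ends N A \<subseteq> D \<and> hash N A I J \<subseteq> D \<union> all_ends N A"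
      by (auto simp: sh_def shuffle_def)
    moreover have "product_exponent N A I J + card (D - {0, N} - sh - X) =
        card (D \<union> all_ends N A) - (card I + card J + 3)"
      if "ends N A \<subseteq> D" "hash N A I J \<subseteq> D \<union> all_ends N A"
      using exponent_identity[OF A pos I D(1-3) that] by (simp add: sh_def X_def)
    ultimately show ?thesis by (auto simp: power_add[symmetric])
  qed
  finally show ?thesis by (simp add: D_def X_def sh_def)
qed

lemma qscale_one: "1 *\<^sub>Q f = f"
  by (rule qsym_eqI) (simp add: qcoeff_scale)

lemma QMq_Nil: "QMq q [] = 1"
proof -
  have "QM [] = (1 :: 'a qsym)"
    by (simp add: Rep_qsym_inject[symmetric] QM.rep_eq one_qsym.rep_eq fun_eq_iff composition_def)
  moreover have "{\<delta>. composition \<delta> \<and> refines \<delta> []} = {[]}"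
    by (auto simp: refines_Nil_iff composition_def)
  ultimately show ?thesis
    by (simp add: QMq_eq_sum_QM composition_def qscale_one)
qed

lemma kth_full:
  assumes "I \<subseteq> {1..N - 1}"
  shows "kth {1..N} ` I = I"
proof -
  have "kth {1..N} i = i" if "i \<in> I" for i
  proof -
    have i: "i \<in> {1..N}" using subsetD[OF assms that] by auto
    then have "{1..i} \<inter> {1..N} = {1..i}" by auto
    then have "rank {1..N} i = card {1..i}" unfolding rank_def by (rule arg_cong)
    then have "rank {1..N} i = i" by simp
    then show ?thesis using kth_rank[of "{1..N}" i] i by simp
  qed
  then show ?thesis by (simp cong: image_cong)
qed

lemma ends_trivial: "ends N {} = {}" "ends N {Suc 0..N} = {}"
  by (auto simp: ends_def)

text \<open>
  In the coefficient at \<open>\<delta>\<close>, the terms of the Cauchy product with \<open>sum_list \<beta> = m\<close> correspond to the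
  sets \<open>A\<close> of size \<open>n\<close> that are final in each block of \<open>\<delta>\<close>, and corresponding terms agree. All other terms
  of either side vanish.
\<close>

lemma product_QMq_positive:
  fixes q :: "'a::comm_ring_1"
  assumes pos: "0 < m" "0 < n" and I: "I \<subseteq> {1..m - 1}" "J \<subseteq> {1..n - 1}"
  shows "QMq q (comp_of m I) * QMq q (comp_of n J) =
    (\<Sum>A | A \<subseteq> {1..m + n} \<and> card A = n. (1 - q) ^ product_exponent (m + n) A I J *\<^sub>Q
      (\<Sum>S | S \<subseteq> ends (m + n) ({1..m + n} - A).
         q ^ card S *\<^sub>Q QMq q (comp_of (m + n) (shuffle (m + n) A I J \<union> S))))"
    (is "?P = (\<Sum>A | ?in A. ?c A *\<^sub>Q ?s A)")
proof (rule qsym_eqI)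
  fix \<delta> assume c: "composition \<delta>"
  define N where "N = m + n"
  let ?f = "\<lambda>\<beta>. qcoeff (QMq q (comp_of m I)) \<beta> * qcoeff (QMq q (comp_of n J)) (map2 (-) \<delta> \<beta>)"
  let ?L = "{\<beta>. list_all2 (\<le>) \<beta> \<delta>}"
  have Ldef: "?L = {\<beta>. length \<beta> = length \<delta> \<and> (\<forall>j<length \<delta>. \<beta> ! j \<le> \<delta> ! j)}"
    by (auto simp: list_all2_conv_all_nth)
  have left: "qcoeff ?P \<delta> = sum ?f ?L"
    unfolding qcoeff_mult Ldef ..
  have zero: "?f \<beta> = 0" if "\<not> (sum_list \<beta> = m \<and> sum_list (map2 (-) \<delta> \<beta>) = n)" for \<beta>
    using that composition_comp_of[OF I(1)] composition_comp_of[OF I(2)]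
    by (auto simp: qcoeff_QMq sum_list_comp_of[OF I(1)] sum_list_comp_of[OF I(2)])
  have "finite {xs. set xs \<subseteq> {..sum_list \<delta>} \<and> length xs = length \<delta>}"
    by (rule finite_lists_length_eq) simp
  moreover have "?L \<subseteq> {xs. set xs \<subseteq> {..sum_list \<delta>} \<and> length xs = length \<delta>}"
  proof clarify
    fix \<beta> assume \<beta>: "list_all2 (\<le>) \<beta> \<delta>"
    then have "sum_list \<beta> \<le> sum_list \<delta>" using sum_list_diff[OF \<beta>] by simp
    then show "set \<beta> \<subseteq> {..sum_list \<delta>} \<and> length \<beta> = length \<delta>"
      using \<beta> member_le_sum_list[of _ \<beta>] by (fastforce dest: list_all2_lengthD)
  qed
  ultimately have finL: "finite ?L" by (rule rev_finite_subset)
  show "qcoeff ?P \<delta> = qcoeff (\<Sum>A | ?in A. ?c A *\<^sub>Q ?s A) \<delta>"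
  proof (cases "sum_list \<delta> = N")
    case False
    have "?f \<beta> = 0" if "\<beta> \<in> ?L" for \<beta>
      using zero[of \<beta>] sum_list_diff[of \<beta> \<delta>] that False by (auto simp: N_def)
    then have "qcoeff ?P \<delta> = 0" unfolding left by (intro sum.neutral) blast
    moreover have "qcoeff (?c A *\<^sub>Q ?s A) \<delta> = 0" if A: "?in A" for A
    proof -
      have "shuffle N A I J \<subseteq> {1..N - 1}"
        by (rule shuffle_subset, rule hash_subset[OF _ _ N_def I]) (use A in \<open>simp_all add: N_def\<close>)
      then have "qcoeff (QMq q (comp_of N (shuffle N A I J \<union> S))) \<delta> = 0"
        if "S \<subseteq> ends N ({1..N} - A)" for S
      proof -
        have K: "shuffle N A I J \<union> S \<subseteq> {1..N - 1}"
          using that \<open>shuffle N A I J \<subseteq> _\<close> by (auto simp: ends_def)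
        show ?thesis
          using False by (simp add: qcoeff_QMq[OF composition_comp_of[OF K]] sum_list_comp_of[OF K])
      qed
      then show ?thesis unfolding N_def[symmetric] by (simp add: qcoeff_scale qcoeff_sum)
    qed
    ultimately show ?thesis by (simp add: qcoeff_sum)
  next
    case True
    define G where "G = {A. A \<subseteq> {1..N} \<and> card A = n \<and> ends N A \<subseteq> psums \<delta>}"
    let ?b = "\<lambda>A. block_counts 0 \<delta> (- A)"
    have final: "A \<in> G \<longleftrightarrow> block_final 0 \<delta> A \<and> card A = n" for A
      unfolding G_def block_final_iff_ends True by blast
    have sum_b: "sum_list (?b A) = m \<longleftrightarrow> card A = n" if "A \<subseteq> {1..N}" for A
    proof -
      have "sum_list (?b A) = card ({1..N} - A)"
        unfolding sum_list_block_counts True by (rule arg_cong[of _ _ card]) auto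
      then show ?thesis
        using that card_mono[OF _ that] finite_subset[OF that] by (auto simp: N_def card_Diff_subset)
    qed
    have "bij_betw ?b G {\<beta> \<in> ?L. sum_list \<beta> = m}"
    proof (rule bij_betw_imageI)
      show "inj_on ?b G"
      proof (rule inj_onI)
        fix A B assume AB: "A \<in> G" "B \<in> G" "?b A = ?b B"
        have "\<exists>!A. block_final 0 \<delta> A \<and> ?b A = ?b B" by (rule block_final_ex1[OF c block_counts_le])
        then show "A = B" using AB unfolding final by blast
      qed
      show "?b ` G = {\<beta> \<in> ?L. sum_list \<beta> = m}"
      proof (intro equalityI subsetI)
        fix \<beta> assume "\<beta> \<in> ?b ` G"
        then show "\<beta> \<in> {\<beta> \<in> ?L. sum_list \<beta> = m}"
          using sum_b block_counts_le by (auto simp: G_def)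
      next
        fix \<beta> assume \<beta>: "\<beta> \<in> {\<beta> \<in> ?L. sum_list \<beta> = m}"
        then obtain A where A: "block_final 0 \<delta> A" "?b A = \<beta>"
          using block_final_ex1[OF c, of \<beta> 0] by blast
        then have "A \<subseteq> {1..N}" using True by (simp add: block_final_iff_ends)
        then have "A \<in> G" using sum_b[of A] A \<beta> by (simp add: final)
        then show "\<beta> \<in> ?b ` G" using A(2) by blast
      qed
    qed
    then have "sum ?f {\<beta> \<in> ?L. sum_list \<beta> = m} = (\<Sum>A\<in>G. ?f (?b A))"
      by (rule sum.reindex_bij_betw[symmetric])
    moreover have "sum ?f ?L = sum ?f {\<beta> \<in> ?L. sum_list \<beta> = m}"
      using zero by (intro sum.mono_neutral_right finL) auto
    ultimately have "qcoeff ?P \<delta> = (\<Sum>A\<in>G. ?f (?b A))" using left by simp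
    also have "\<dots> = (\<Sum>A\<in>G. qcoeff (?c A *\<^sub>Q ?s A) \<delta>)"
    proof (rule sum.cong[OF refl])
      fix A assume "A \<in> G"
      then have A: "A \<subseteq> {1..N}" "card A = n" "ends N A \<subseteq> psums \<delta>" by (auto simp: G_def)
      show "?f (?b A) = qcoeff (?c A *\<^sub>Q ?s A) \<delta>"
        unfolding diff_block_counts N_def[symmetric]
        using qcoeff_mult_block_counts[OF A(1,2) N_def pos I True A(3), of q]
          qcoeff_shuffle_term[OF A(1,2) N_def pos I True, of q] A(3) by simp
    qed
    also have "\<dots> = (\<Sum>A | ?in A. qcoeff (?c A *\<^sub>Q ?s A) \<delta>)"
    proof (rule sum.mono_neutral_left)
      show "\<forall>A\<in>{A. ?in A} - G. qcoeff (?c A *\<^sub>Q ?s A) \<delta> = 0"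
      proof
        fix A assume "A \<in> {A. ?in A} - G"
        then have A: "A \<subseteq> {1..N}" "card A = n" "\<not> ends N A \<subseteq> psums \<delta>" by (auto simp: G_def N_def)
        show "qcoeff (?c A *\<^sub>Q ?s A) \<delta> = 0"
          unfolding N_def[symmetric]
          using qcoeff_shuffle_term[OF A(1,2) N_def pos I True, of q] A(3) by simp
      qed
    qed (auto simp: G_def N_def)
    finally show ?thesis by (simp add: qcoeff_sum)
  qed
qed

text \<open>
  If one factor has degree 0, it is the unit, there is a single set \<open>A\<close>, it has no ends, and the
  right-hand side is the other factor.
\<close>

lemma product_QMq:
  fixes q :: "'a::comm_ring_1"
  assumes I: "I \<subseteq> {1..m - 1}" "J \<subseteq> {1..n - 1}"
  shows "QMq q (comp_of m I) * QMq q (comp_of n J) =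
    (\<Sum>A | A \<subseteq> {1..m + n} \<and> card A = n. (1 - q) ^ product_exponent (m + n) A I J *\<^sub>Q
      (\<Sum>S | S \<subseteq> ends (m + n) ({1..m + n} - A).
         q ^ card S *\<^sub>Q QMq q (comp_of (m + n) (shuffle (m + n) A I J \<union> S))))"
proof -
  consider "m = 0" | "n = 0" | "0 < m" "0 < n" by blast
  then show ?thesis
  proof cases
    case 1
    then have "I = {}" using I by simp
    have "{A. A \<subseteq> {1..m + n} \<and> card A = n} = {{1..n}}"
    proof (intro equalityI subsetI)
      fix A assume "A \<in> {A. A \<subseteq> {1..m + n} \<and> card A = n}"
      then have "A \<subseteq> {1..n}" "card A = card {1..n}" using 1 by simp_all
      then show "A \<in> {{1..n}}" using card_subset_eq[of "{1..n}" A] by simp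
    qed (use 1 in simp)
    moreover have "shuffle n {1..n} I J = J"
      unfolding shuffle_def hash_def all_ends_def
      using \<open>I = {}\<close> kth_full[OF I(2)] by (simp add: ends_trivial)
    moreover have "QMq q (comp_of m I) = 1" using 1 by (simp add: comp_of_def QMq_Nil)
    ultimately show ?thesis
      using 1 by (simp add: product_exponent_def all_ends_def ends_trivial qscale_one)
  next
    case 2
    then have "J = {}" using I by simp
    have "{A. A \<subseteq> {1..m + n} \<and> card A = n} = {{}}"
    proof (intro equalityI subsetI)
      fix A assume "A \<in> {A. A \<subseteq> {1..m + n} \<and> card A = n}"
      then have "finite A" "card A = 0" using 2 finite_subset[of A "{1..m + n}"] by simp_all
      then show "A \<in> {{}}" by simp
    qed (use 2 in simp)
    moreover have "shuffle m {} I J = I"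
      unfolding shuffle_def hash_def all_ends_def
      using \<open>J = {}\<close> kth_full[OF I(1)] by (simp add: ends_trivial)
    moreover have "QMq q (comp_of n J) = 1" using 2 by (simp add: comp_of_def QMq_Nil)
    ultimately show ?thesis
      using 2 by (simp add: product_exponent_def all_ends_def ends_trivial qscale_one)
  next
    case 3
    then show ?thesis by (rule product_QMq_positive[OF _ _ I])
  qed
qed

theorem theorem6p1:
  shows "(\<forall>(m::nat) (n::nat) I J. I \<subseteq> {1..m - 1} \<longrightarrow> J \<subseteq> {1..n - 1} \<longrightarrow>
      QMq qvar (comp_of m I) * QMq qvar (comp_of n J) =
        (\<Sum>A | A \<subseteq> {1..m + n} \<and> card A = n.
          (1 - qvar) ^ product_exponent (m + n) A I J *\<^sub>Q
          (\<Sum>S | S \<subseteq> ends (m + n) ({1..m + n} - A).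
             qvar ^ card S *\<^sub>Q QMq qvar (comp_of (m + n) (shuffle (m + n) A I J \<union> S)))))
    \<and> (\<forall>\<gamma>. composition \<gamma> \<longrightarrow>
      \<triangle> (QMq qvar \<gamma>) =
        (\<Sum>(\<alpha>, \<beta>) | composition \<alpha> \<and> composition \<beta> \<and> (\<alpha> @ \<beta> = \<gamma> \<or> \<alpha> \<odot> \<beta> = \<gamma>).
          (1 - qvar) ^ coproduct_exponent \<gamma> \<alpha> \<beta> *\<^sub>T (QMq qvar \<alpha> \<otimes>\<^sub>Q QMq qvar \<beta>)))"
  using product_QMq[where q = qvar] coproduct_QMq[where q = qvar] by blast

end
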